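(* Let $B$ be a skew-symmetrizable integer matrix whose diagram is of one of the types $X_6$, $X_7$, $E_6^{(1,1)}$, $E_7^{(1,1)}$, $E_8^{(1,1)}$, $G_2^{( *,+)}$, $G_2^{( *,* )}$, $F_4^{( *,+)}$, $F_4^{( *,* )}$. Then the coefficient-free cluster algebra $\mathcal A(B)$ has exponential growth.
   Context: A matrix $B=(b_{ij})\in\mathbb Z^{n\times n}$ is skew-symmetrizable if $BD$ is skew-symmetric for some diagonal $D$ with positive integer diagonal entries. Mutation in direction $k$: $\mu_k(B)=B'$ with $b'_{ij}=-b_{ij}$ if $k\in\{i,j\}$, and $b'_{ij}=b_{ij}+\tfrac12(|b_{ik}|b_{kj}+b_{ik}|b_{kj}|)$ otherwise. The coefficient-free cluster algebra $\mathcal A(B)$ is generated inside $\mathbb Q(x_1,\dots,x_n)$ by the cluster variables of all seeds obtained from the initial seed $((x_1,\dots,x_n),B)$ by iterated mutations, where mutation at $k$ replaces $B$ by $\mu_k(B)$ and $x_k$ by $x_k'=\big(\prod_i x_i^{[b_{ik}]_+}+\prod_i x_i^{[-b_{ik}]_+}\big)/x_k$ ($[a]_+=\max(a,0)$). The exchange graph is obtained from the $n$-regular tree of seeds (edges = single mutations) by identifying vertices whose clusters coincide as sets. Let $f(N)$ be the number of vertices of the exchange graph at distance at most $N$ from the initial vertex; $\mathcal A(B)$ has exponential growth if there is $c>1$ with $f(N)\ge c^N$ for all sufficiently large $N$. The diagram of $B$ has vertices $1,\dots,n$ and an arrow $i\to j$ whenever $b_{ij}>0$, with weight $-b_{ij}b_{ji}$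 (weights $1$ are omitted). We say the diagram of $B$ is of type $S$ (for a diagram $S$) if some matrix obtained from $B$ by a sequence of mutations and a simultaneous permutation of rows and columns has diagram $S$ or the diagram obtained from $S$ by reversing all arrows. The diagrams are: $X_6$: vertices $c,a_1,b_1,a_2,b_2,e$; arrows $c\to a_i$, $a_i\to b_i$ (weight $4$), $b_i\to c$ for $i=1,2$, and $c\to e$. $X_7$: vertices $c,a_i,b_i$ ($i=1,2,3$); arrows $c\to a_i$, $a_i\to b_i$ (weight $4$), $b_i\to c$. $E_6^{(1,1)},E_7^{(1,1)},E_8^{(1,1)}$: vertices $u,v$ with an arrow $u\to v$ of weight $4$, and three arms of lengths $(\ell_1,\ell_2,\ell_3)=(2,2,2)$, $(1,3,3)$, $(1,2,5)$ respectively; arm $i$ has vertices $w_{i,1},\dots,w_{i,\ell_i}$ with arrows $v\to w_{i,1}$, $w_{i,1}\to u$, $w_{i,j}\to w_{i,j+1}$ (all weight $1$). $G_2^{( *,+)}$: vertices $u,v,w,x$; $u\to v$ weight $4$, $v\to w$ and $w\to u$ weight $3$, $w\to x$ weight $1$. $G_2^{( *,* )}$: vertices $u,v,p,q$; $u\to v$ weight $4$; $v\to p$, $p\to u$ weight $1$; $v\to q$, $q\to u$ weight $3$. $F_4^{( *,+)}$: vertices $u,v,p,q_1,q_2,q_3$; $u\to v$ weight $4$; $v\to p$, $p\to u$ weight $1$; $v\to q_1$, $q_1\to u$ weight $2$; $q_1\to q_2$, $q_2\to q_3$ weight $1$. $F_4^{( *,* )}$: vertices $u,v,p_1,p_2,q_1,q_2$;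 $u\to v$ weight $4$; $v\to p_1$, $p_1\to u$ weight $1$; $p_1\to p_2$ weight $1$; $v\to q_1$, $q_1\to u$ weight $2$; $q_1\to q_2$ weight $1$. *)

theory Defs
  imports
    Complex_Main
    "HOL-Library.Poly_Mapping"
    "HOL-Library.Extended_Real"
    "HOL-Computational_Algebra.Fraction_Field"
    "HOL-Combinatorics.Permutations"
    "Jordan_Normal_Form.Matrix"
begin

text \<open>All indices are shifted to start at 0: an \<open>n \<times> n\<close> matrix has rows and columns
  \<open>0, \<dots>, n - 1\<close>.\<close>

section \<open>Matrix mutation\<close>

definition skew_symmetrizable :: "int mat \<Rightarrow> bool" where
  "skew_symmetrizable B \<longleftrightarrow> square_mat B \<and>
     (\<exists>D \<in> carrier_mat (dim_row B) (dim_row B).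
        diagonal_mat D \<and> (\<forall>i < dim_row B. 0 < D $$ (i, i)) \<and>
        transpose_mat (B * D) = - (B * D))"

text \<open>The number halved is \<open>0\<close> or \<open>\<plusminus> 2 b\<^sub>i\<^sub>k b\<^sub>k\<^sub>j\<close>,
  so the integer division is exact.\<close>

definition mutate_mat :: "int mat \<Rightarrow> nat \<Rightarrow> int mat" where
  "mutate_mat B k = mat (dim_row B) (dim_col B) (\<lambda>(i, j).
     if k = i \<or> k = j then - B $$ (i, j)
     else B $$ (i, j) + (\<bar>B $$ (i, k)\<bar> * B $$ (k, j) + B $$ (i, k) * \<bar>B $$ (k, j)\<bar>) div 2)"

section \<open>Seeds and the exchange graph\<close>

text \<open>Rational functions over \<open>\<rat>\<close>. There are variables \<open>x\<^sub>i\<close> for all natural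
  numbers \<open>i\<close>; the seeds of an \<open>n \<times> n\<close> matrix only involve \<open>x\<^sub>0, \<dots>, x\<^sub>n\<^sub>-\<^sub>1\<close>
  and so live in the subfield \<open>\<rat>(x\<^sub>0, \<dots>, x\<^sub>n\<^sub>-\<^sub>1)\<close>.\<close>

type_synonym ratfun = "((nat \<Rightarrow>\<^sub>0 nat) \<Rightarrow>\<^sub>0 rat) fract"

definition ratfun_var :: "nat \<Rightarrow> ratfun" where
  "ratfun_var i = Fract (Poly_Mapping.single (Poly_Mapping.single i 1) 1) 1"

type_synonym seed = "ratfun vec \<times> int mat"

definition initial_seed :: "int mat \<Rightarrow> seed" where
  "initial_seed B = (vec (dim_row B) ratfun_var, B)"

definition exchanged_var :: "seed \<Rightarrow> nat \<Rightarrow> ratfun" where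
  "exchanged_var s k = (case s of (x, B) \<Rightarrow>
     ((\<Prod>i < dim_vec x. (x $ i) ^ nat (max (B $$ (i, k)) 0)) +
      (\<Prod>i < dim_vec x. (x $ i) ^ nat (max (- B $$ (i, k)) 0))) / (x $ k))"

definition mutate_seed :: "seed \<Rightarrow> nat \<Rightarrow> seed" where
  "mutate_seed s k = (case s of (x, B) \<Rightarrow>
     (vec (dim_vec x) (\<lambda>i. if i = k then exchanged_var s k else x $ i), mutate_mat B k))"

text \<open>The \<open>n\<close>-regular tree: a vertex is the list of edge labels on the path
  from the initial vertex to it; paths do not backtrack.\<close>

definition tree_verts :: "nat \<Rightarrow> nat list set" where
  "tree_verts n = {w. set w \<subseteq> {..<n} \<and> distinct_adj w}"

definition tree_edges :: "nat \<Rightarrow> (nat list \<times> nat list) set" where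
  "tree_edges n = {(w, w'). w \<in> tree_verts n \<and> w' \<in> tree_verts n \<and>
     (\<exists>k. w' = w @ [k] \<or> w = w' @ [k])}"

definition seed_at :: "int mat \<Rightarrow> nat list \<Rightarrow> seed" where
  "seed_at B w = foldl mutate_seed (initial_seed B) w"

definition cluster_at :: "int mat \<Rightarrow> nat list \<Rightarrow> ratfun set" where
  "cluster_at B w = vec_set (fst (seed_at B w))"

definition same_cluster :: "int mat \<Rightarrow> (nat list \<times> nat list) set" where
  "same_cluster B = {(w, w'). w \<in> tree_verts (dim_row B) \<and> w' \<in> tree_verts (dim_row B) \<and>
     cluster_at B w = cluster_at B w'}"

definition exchange_verts :: "int mat \<Rightarrow> nat list set set" where
  "exchange_verts B = tree_verts (dim_row B) // same_cluster B"

definition exchange_edges :: "int mat \<Rightarrow> (nat list set \<times> nat list set) set" where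
  "exchange_edges B =
     {(same_cluster B `` {w}, same_cluster B `` {w'}) | w w'. (w, w') \<in> tree_edges (dim_row B)}"

definition exchange_root :: "int mat \<Rightarrow> nat list set" where
  "exchange_root B = same_cluster B `` {[]}"

section \<open>Growth\<close>

definition graph_dist :: "('v \<times> 'v) set \<Rightarrow> 'v \<Rightarrow> 'v \<Rightarrow> enat" where
  "graph_dist E u v = (INF m \<in> {m. (u, v) \<in> E ^^ m}. enat m)"

text \<open>The number of elements of a set. Unlike \<open>card\<close>, it is \<open>\<infinity>\<close>, not \<open>0\<close>,
  for an infinite set.\<close>

definition num_elems :: "'v set \<Rightarrow> enat" where
  "num_elems A = (if finite A then enat (card A) else \<infinity>)"

definition growth_fun :: "int mat \<Rightarrow> nat \<Rightarrow> enat" where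
  "growth_fun B N = num_elems {v \<in> exchange_verts B.
     graph_dist (exchange_edges B) (exchange_root B) v \<le> enat N}"

text \<open>Exponential growth of the coefficient-free cluster algebra \<open>\<A>(B)\<close>.\<close>

definition exponential_growth :: "int mat \<Rightarrow> bool" where
  "exponential_growth B \<longleftrightarrow>
     (\<exists>c::real. c > 1 \<and> (\<forall>\<^sub>F N in sequentially. ereal (c ^ N) \<le> ereal_of_enat (growth_fun B N)))"

section \<open>Diagrams\<close>

text \<open>A diagram is a pair \<open>(n, A)\<close>: the vertices are \<open>0, \<dots>, n - 1\<close>, and
  \<open>(i, j, w) \<in> A\<close> is an arrow \<open>i \<rightarrow> j\<close> of weight \<open>w\<close>.\<close>

type_synonym diagram = "nat \<times> (nat \<times> nat \<times> int) set"

definition diagram_of :: "int mat \<Rightarrow> diagram" where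
  "diagram_of B = (dim_row B,
     {(i, j, - (B $$ (i, j) * B $$ (j, i))) | i j.
        i < dim_row B \<and> j < dim_row B \<and> 0 < B $$ (i, j)})"

definition reverse_diagram :: "diagram \<Rightarrow> diagram" where
  "reverse_diagram S = (fst S, (\<lambda>(i, j, w). (j, i, w)) ` snd S)"

definition permute_mat :: "(nat \<Rightarrow> nat) \<Rightarrow> int mat \<Rightarrow> int mat" where
  "permute_mat p B = mat (dim_row B) (dim_col B) (\<lambda>(i, j). B $$ (p i, p j))"

definition of_diagram_type :: "int mat \<Rightarrow> diagram \<Rightarrow> bool" where
  "of_diagram_type B S \<longleftrightarrow>
     (\<exists>ks p. set ks \<subseteq> {..<dim_row B} \<and> p permutes {..<dim_row B} \<and>
        diagram_of (permute_mat p (foldl mutate_mat B ks)) \<in> {S, reverse_diagram S})"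

text \<open>In the next two diagrams \<open>c = 0\<close>, \<open>a\<^sub>i = 2 i - 1\<close>, \<open>b\<^sub>i = 2 i\<close>, and \<open>e = 5\<close>.\<close>

definition X6 :: diagram where
  "X6 = (6,
     {(0, 1, 1), (1, 2, 4), (2, 0, 1),
      (0, 3, 1), (3, 4, 4), (4, 0, 1),
      (0, 5, 1)})"

definition X7 :: diagram where
  "X7 = (7,
     {(0, 1, 1), (1, 2, 4), (2, 0, 1),
      (0, 3, 1), (3, 4, 4), (4, 0, 1),
      (0, 5, 1), (5, 6, 4), (6, 0, 1)})"

text \<open>In all remaining diagrams \<open>u = 0\<close> and \<open>v = 1\<close>. An arm of length \<open>l\<close> with
  vertices \<open>w\<^sub>1 = s, \<dots>, w\<^sub>l = s + l - 1\<close>:\<close>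

definition arm :: "nat \<Rightarrow> nat \<Rightarrow> (nat \<times> nat \<times> int) set" where
  "arm s l = {(1, s, 1), (s, 0, 1)} \<union> {(s + j, s + j + 1, 1) | j. j + 1 < l}"

definition three_arms :: "nat \<Rightarrow> nat \<Rightarrow> nat \<Rightarrow> diagram" where
  "three_arms l1 l2 l3 = (2 + l1 + l2 + l3,
     {(0, 1, 4)} \<union> arm 2 l1 \<union> arm (2 + l1) l2 \<union> arm (2 + l1 + l2) l3)"

definition E6_11 :: diagram where "E6_11 = three_arms 2 2 2"

definition E7_11 :: diagram where "E7_11 = three_arms 1 3 3"

definition E8_11 :: diagram where "E8_11 = three_arms 1 2 5"

text \<open>\<open>w = 2\<close>, \<open>x = 3\<close>.\<close>

definition G2_star_plus :: diagram where
  "G2_star_plus = (4, {(0, 1, 4), (1, 2, 3), (2, 0, 3), (2, 3, 1)})"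

text \<open>\<open>p = 2\<close>, \<open>q = 3\<close>.\<close>

definition G2_star_star :: diagram where
  "G2_star_star = (4, {(0, 1, 4), (1, 2, 1), (2, 0, 1), (1, 3, 3), (3, 0, 3)})"

text \<open>\<open>p = 2\<close>, \<open>q\<^sub>1 = 3\<close>, \<open>q\<^sub>2 = 4\<close>, \<open>q\<^sub>3 = 5\<close>.\<close>

definition F4_star_plus :: diagram where
  "F4_star_plus = (6,
     {(0, 1, 4), (1, 2, 1), (2, 0, 1), (1, 3, 2), (3, 0, 2), (3, 4, 1), (4, 5, 1)})"

text \<open>\<open>p\<^sub>1 = 2\<close>, \<open>p\<^sub>2 = 3\<close>, \<open>q\<^sub>1 = 4\<close>, \<open>q\<^sub>2 = 5\<close>.\<close>

definition F4_star_star :: diagram where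
  "F4_star_star = (6,
     {(0, 1, 4), (1, 2, 1), (2, 0, 1), (2, 3, 1), (1, 4, 2), (4, 0, 2), (4, 5, 1)})"

end

theory Submission
  imports Defs
begin

text \<open>
  Cluster variables are subtraction-free, so they can be evaluated in the max-plus semifield of
  integers at any integer point. Along a path of seeds the vector of these values changes by
  piecewise linear maps. For every diagram in the list there are, at some mutation-equivalent
  matrix, two mutation sequences which return to the same matrix and two independent integer
  vectors \<open>p\<close> and \<open>q\<close> such that on the cone spanned by \<open>p\<close> and \<open>q\<close> the two sequences act
  linearly, as \<open>q \<mapsto> q + k p\<close> (fixing \<open>p\<close>) and as \<open>p \<mapsto> p + l q\<close> (fixing \<open>q\<close>). These two
  shears generate a free monoid, and different elements move \<open>p + q\<close> to different points. Since a
  cluster, as a set, leaves at most \<open>n\<^sup>2\<close> possibilities for the coefficients of \<open>p\<close> and \<open>q\<close>, the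
  number of clusters within a given distance grows exponentially.
\<close>

section \<open>Tropical evaluation\<close>

text \<open>The exchange graph identifies seeds by clusters as unordered sets of rational functions,
  so counting its vertices needs an invariant of such sets that can be computed along a path without
  expanding the functions. A max-plus value serves because it belongs to the function itself,
  whatever positive numerator and denominator represent it. The evaluation point must be chosen at
  the initial seed, whereas the two sequences start at another matrix; since tropical mutation can
  be undone, \<open>p + q\<close> there is the image of a point at the initial seed. Any positive
  multipliers of the shears are enough: both shears keep the coefficients positive, and only words
  in the two, not in their inverses, are used. Linearity on a cone can be checked by following its
  two spanning rays, provided that the same side of every maximum wins on both. Finally, a diagram
  fixes only the products of opposite entries, up to reversal and renumbering; hence the transport
  along negation and permutation, and the case analysis with symmetrizing weights.\<close>

definition weight :: "int vec \<Rightarrow> (nat \<Rightarrow>\<^sub>0 nat) \<Rightarrow> int" where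
  "weight a m = (\<Sum>i<dim_vec a. a $ i * int (Poly_Mapping.lookup m i))"

lemma weight_add: "weight a (m + m') = weight a m + weight a m'"
  by (simp add: weight_def lookup_add algebra_simps sum.distrib)

lemma weight_zero [simp]: "weight a 0 = 0"
  by (simp add: weight_def)

lemma weight_single: "i < dim_vec a \<Longrightarrow> weight a (Poly_Mapping.single i 1) = a $ i"
  by (simp add: weight_def lookup_single when_def if_distrib cong: if_cong)

text \<open>Building the polynomial from monomials with positive coefficients excludes zero and
  cancellation; for arbitrary polynomials the degree of a sum is only bounded by the
  maximum.\<close>

inductive pos_poly_degree :: "int vec \<Rightarrow> ((nat \<Rightarrow>\<^sub>0 nat) \<Rightarrow>\<^sub>0 rat) \<Rightarrow> int \<Rightarrow> bool"
  for a where
  single: "0 < c \<Longrightarrow> pos_poly_degree a (Poly_Mapping.single m c) (weight a m)"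
| add: "pos_poly_degree a p d \<Longrightarrow> pos_poly_degree a q e \<Longrightarrow> pos_poly_degree a (p + q) (max d e)"

text \<open>With nonnegative coefficients the support of a sum is the union of the supports. The
  value is thus read off from the polynomial alone, whatever its derivation.\<close>

lemma pos_poly_degree_Max:
  assumes "pos_poly_degree a p d"
  shows "Poly_Mapping.keys p \<noteq> {} \<and> (\<forall>m. 0 \<le> Poly_Mapping.lookup p m) \<and>
    d = Max (weight a ` Poly_Mapping.keys p)"
  using assms
proof induction
  case (single c m)
  then show ?case by (auto simp: lookup_single when_def)
next
  case (add p d q e)
  have nz: "Poly_Mapping.lookup p m + Poly_Mapping.lookup q m = 0 \<longleftrightarrow>
      Poly_Mapping.lookup p m = 0 \<and> Poly_Mapping.lookup q m = 0" for m
    using add.IH by (simp add: add_nonneg_eq_0_iff)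
  have "Poly_Mapping.keys (p + q) = Poly_Mapping.keys p \<union> Poly_Mapping.keys q"
    by (auto simp: in_keys_iff lookup_add nz)
  with add.IH show ?case
    by (simp add: image_Un Max_Un lookup_add)
qed

lemma pos_poly_degree_unique:
  "pos_poly_degree a p d \<Longrightarrow> pos_poly_degree a p e \<Longrightarrow> d = e"
  by (metis pos_poly_degree_Max)

lemma pos_poly_degree_nonzero: "pos_poly_degree a p d \<Longrightarrow> p \<noteq> 0"
  using pos_poly_degree_Max by fastforce

lemma pos_poly_degree_mult_single:
  assumes "0 < c" "pos_poly_degree a q e"
  shows "pos_poly_degree a (Poly_Mapping.single m c * q) (weight a m + e)"
  using assms(2)
proof induction
  case (single c' m')
  with \<open>0 < c\<close> show ?case
    using pos_poly_degree.single[of "c * c'" a "m + m'"] by (simp add: mult_single weight_add)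
next
  case (add p d q e)
  then show ?case
    using pos_poly_degree.add[OF add.IH] by (simp add: distrib_left max_add_distrib_right)
qed

lemma pos_poly_degree_mult:
  assumes "pos_poly_degree a p d" "pos_poly_degree a q e"
  shows "pos_poly_degree a (p * q) (d + e)"
  using assms(1)
proof induction
  case (single c m)
  then show ?case using pos_poly_degree_mult_single assms(2) by simp
next
  case (add p d p' d')
  then show ?case
    using pos_poly_degree.add[OF add.IH] by (simp add: distrib_right max_add_distrib_left)
qed

text \<open>A relation, because only fractions with a positive representation have a value.\<close>

definition tropical_value :: "int vec \<Rightarrow> ratfun \<Rightarrow> int \<Rightarrow> bool" where
  "tropical_value a r t \<longleftrightarrow> (\<exists>p q d e. pos_poly_degree a p d \<and> pos_poly_degree a q e \<and>
     r = Fract p q \<and> t = d - e)"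

text \<open>Two positive representations are cross-multiplied, and degrees add under products. This
  makes the value an invariant of the cluster variable instead of the path producing it.\<close>

lemma tropical_value_unique:
  assumes "tropical_value a r t" "tropical_value a r t'"
  shows "t = t'"
proof -
  obtain p q d e where 1: "pos_poly_degree a p d" "pos_poly_degree a q e" "r = Fract p q" "t = d - e"
    using assms(1) by (auto simp: tropical_value_def)
  obtain p' q' d' e' where 2: "pos_poly_degree a p' d'" "pos_poly_degree a q' e'"
    "r = Fract p' q'" "t' = d' - e'"
    using assms(2) by (auto simp: tropical_value_def)
  have "p * q' = p' * q"
    using 1 2 by (simp add: eq_fract pos_poly_degree_nonzero)
  then have "d + e' = d' + e"
    using pos_poly_degree_mult[OF 1(1) 2(2)] pos_poly_degree_mult[OF 2(1) 1(2)]
      pos_poly_degree_unique by metis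
  with 1 2 show ?thesis by simp
qed

lemma tropical_value_nonzero:
  assumes "tropical_value a r t"
  shows "r \<noteq> 0"
proof -
  obtain p q d e where "pos_poly_degree a p d" "pos_poly_degree a q e" "r = Fract p q"
    using assms by (auto simp: tropical_value_def)
  then show ?thesis
    using eq_fract(1)[of q 1 p 0] by (simp add: Zero_fract_def pos_poly_degree_nonzero)
qed

lemma tropical_value_mult:
  assumes "tropical_value a r t" "tropical_value a s u"
  shows "tropical_value a (r * s) (t + u)"
proof -
  obtain p q d e where 1: "pos_poly_degree a p d" "pos_poly_degree a q e" "r = Fract p q" "t = d - e"
    using assms(1) by (auto simp: tropical_value_def)
  obtain p' q' d' e' where 2: "pos_poly_degree a p' d'" "pos_poly_degree a q' e'"
    "s = Fract p' q'" "u = d' - e'"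
    using assms(2) by (auto simp: tropical_value_def)
  show ?thesis
    unfolding tropical_value_def
    using pos_poly_degree_mult[OF 1(1) 2(1)] pos_poly_degree_mult[OF 1(2) 2(2)] 1 2
    by (intro exI conjI) (auto simp: mult_fract)
qed

lemma tropical_value_add:
  assumes "tropical_value a r t" "tropical_value a s u"
  shows "tropical_value a (r + s) (max t u)"
proof -
  obtain p q d e where 1: "pos_poly_degree a p d" "pos_poly_degree a q e" "r = Fract p q" "t = d - e"
    using assms(1) by (auto simp: tropical_value_def)
  obtain p' q' d' e' where 2: "pos_poly_degree a p' d'" "pos_poly_degree a q' e'"
    "s = Fract p' q'" "u = d' - e'"
    using assms(2) by (auto simp: tropical_value_def)
  have "r + s = Fract (p * q' + p' * q) (q * q')"
    using 1 2 by (simp add: add_fract pos_poly_degree_nonzero)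
  moreover have "pos_poly_degree a (p * q' + p' * q) (max (d + e') (d' + e))"
    using 1 2 by (intro pos_poly_degree.add pos_poly_degree_mult)
  moreover have "max t u = max (d + e') (d' + e) - (e + e')"
    using 1 2 by simp
  ultimately show ?thesis
    unfolding tropical_value_def using pos_poly_degree_mult[OF 1(2) 2(2)] by blast
qed

lemma tropical_value_divide:
  assumes "tropical_value a r t" "tropical_value a s u"
  shows "tropical_value a (r / s) (t - u)"
proof -
  obtain p q d e where "pos_poly_degree a p d" "pos_poly_degree a q e" "s = Fract p q" "u = d - e"
    using assms(2) by (auto simp: tropical_value_def)
  then have "tropical_value a (inverse s) (- u)"
    unfolding tropical_value_def by (intro exI[of _ q] exI[of _ p] exI[of _ e] exI[of _ d]) simp
  from tropical_value_mult[OF assms(1) this] show ?thesis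
    by (simp add: divide_inverse)
qed

lemma pos_poly_degree_one: "pos_poly_degree a 1 0"
  using pos_poly_degree.single[of 1 a 0] by simp

lemma tropical_value_one: "tropical_value a 1 0"
  unfolding tropical_value_def One_fract_def
  using pos_poly_degree_one by (intro exI conjI) auto

lemma tropical_value_power:
  "tropical_value a r t \<Longrightarrow> tropical_value a (r ^ k) (int k * t)"
  by (induction k) (auto simp: tropical_value_one algebra_simps dest: tropical_value_mult)

lemma tropical_value_prod:
  assumes "\<And>i. i \<in> I \<Longrightarrow> tropical_value a (r i) (t i)"
  shows "tropical_value a (prod r I) (sum t I)"
  using assms
  by (induction I rule: infinite_finite_induct)
    (auto simp: tropical_value_one intro: tropical_value_mult)

lemma tropical_value_var:
  assumes "i < dim_vec a"
  shows "tropical_value a (ratfun_var i) (a $ i)"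
proof -
  have "pos_poly_degree a (Poly_Mapping.single (Poly_Mapping.single i 1) 1) (a $ i)"
    using pos_poly_degree.single[of 1 a "Poly_Mapping.single i 1"] weight_single[OF assms] by simp
  then show ?thesis
    unfolding tropical_value_def ratfun_var_def
    using pos_poly_degree_one by (intro exI conjI) auto
qed

section \<open>Tropical seeds\<close>

text \<open>The correction term sgn(x) max(x y, 0) of matrix mutation, in a form free of the
  division by 2.\<close>

definition mutation_term :: "int \<Rightarrow> int \<Rightarrow> int" where
  "mutation_term x y =
     (if 0 < x \<and> 0 < y then x * y else if x < 0 \<and> y < 0 then - (x * y) else 0)"

lemma half_abs_eq_mutation_term: "(\<bar>x\<bar> * y + x * \<bar>y\<bar>) div 2 = mutation_term x y"
proof -
  have "\<bar>x\<bar> * y + x * \<bar>y\<bar> = 2 * mutation_term x y"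
    by (cases x "0 :: int" rule: linorder_cases; cases y "0 :: int" rule: linorder_cases)
      (simp_all add: mutation_term_def)
  then show ?thesis by simp
qed

lemma mutation_term_minus: "mutation_term (- x) (- y) = - mutation_term x y"
  by (simp add: mutation_term_def)

lemma mutate_mat_eq:
  "mutate_mat B k = mat (dim_row B) (dim_col B) (\<lambda>(i, j).
     if k = i \<or> k = j then - B $$ (i, j) else B $$ (i, j) + mutation_term (B $$ (i, k)) (B $$ (k, j)))"
  by (rule eq_matI) (auto simp: mutate_mat_def half_abs_eq_mutation_term)

lemma dim_mutate_mat [simp]:
  "dim_row (mutate_mat B k) = dim_row B" "dim_col (mutate_mat B k) = dim_col B"
  by (auto simp: mutate_mat_def)

lemma mutate_mat_carrier [simp]:
  "B \<in> carrier_mat n n \<Longrightarrow> mutate_mat B k \<in> carrier_mat n n"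
  by (intro carrier_matI) (simp_all add: carrier_matD)

lemma foldl_mutate_mat_carrier [simp]:
  "B \<in> carrier_mat n n \<Longrightarrow> foldl mutate_mat B w \<in> carrier_mat n n"
  by (induction w rule: rev_induct) auto

text \<open>Row and column \<open>k\<close> change sign, and the correction term changes sign when
  both of its arguments do, so the second correction cancels the first.\<close>

lemma mutate_mat_mutate_mat:
  assumes "B \<in> carrier_mat n n" "k < n"
  shows "mutate_mat (mutate_mat B k) k = B"
  using assms by (intro eq_matI) (auto simp: mutate_mat_eq mutation_term_minus)

section \<open>Symmetrizing weights and their invariance under mutation\<close>

definition skew_weights :: "(nat \<Rightarrow> int) \<Rightarrow> int mat \<Rightarrow> bool" where
  "skew_weights d B \<longleftrightarrow> (\<forall>i < dim_row B. 0 < d i) \<and>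
     (\<forall>i < dim_row B. \<forall>j < dim_row B. B $$ (i, j) * d j = - (B $$ (j, i) * d i))"

lemma skew_symmetrizable_imp_skew_weights:
  assumes "skew_symmetrizable B"
  obtains d where "skew_weights d B"
proof -
  obtain D where D: "D \<in> carrier_mat (dim_row B) (dim_row B)" "diagonal_mat D"
      "\<forall>i < dim_row B. 0 < D $$ (i, i)" "transpose_mat (B * D) = - (B * D)"
    and sq: "dim_col B = dim_row B"
    using assms by (auto simp: skew_symmetrizable_def)
  have BD: "(B * D) $$ (i, j) = B $$ (i, j) * D $$ (j, j)" if "i < dim_row B" "j < dim_row B" for i j
  proof -
    have "(B * D) $$ (i, j) = (\<Sum>l<dim_row B. B $$ (i, l) * D $$ (l, j))"
      using that D(1) sq by (simp add: scalar_prod_def atLeast0LessThan)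
    also have "\<dots> = (\<Sum>l<dim_row B. if l = j then B $$ (i, j) * D $$ (j, j) else 0)"
      using that D(1,2) by (intro sum.cong) (auto simp: diagonal_mat_def)
    finally show ?thesis using that by simp
  qed
  have "B $$ (i, j) * D $$ (j, j) = - (B $$ (j, i) * D $$ (i, i))"
    if "i < dim_row B" "j < dim_row B" for i j
  proof -
    have "(B * D) $$ (i, j) = transpose_mat (B * D) $$ (j, i)"
      using that D(1) sq by simp
    also have "\<dots> = - (B * D) $$ (j, i)"
      using that D(1) sq by (subst D(4)) simp
    finally show ?thesis using that by (simp add: BD)
  qed
  with D(3) have "skew_weights (\<lambda>i. D $$ (i, i)) B"
    unfolding skew_weights_def by blast
  then show thesis by (rule that)
qed

lemma skew_weights_sign:
  assumes "skew_weights d B" "i < dim_row B" "j < dim_row B"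
  shows "B $$ (i, j) > 0 \<longleftrightarrow> B $$ (j, i) < 0"
proof -
  have e: "B $$ (i, j) * d j = - (B $$ (j, i) * d i)" and d: "0 < d i" "0 < d j"
    using assms unfolding skew_weights_def by blast+
  have "0 < B $$ (i, j) * d j \<longleftrightarrow> 0 < B $$ (i, j)" "B $$ (j, i) * d i < 0 \<longleftrightarrow> B $$ (j, i) < 0"
    using d by (simp_all add: zero_less_mult_iff mult_less_0_iff)
  with e show ?thesis by linarith
qed

lemma skew_weights_diag:
  assumes "skew_weights d B" "i < dim_row B"
  shows "B $$ (i, i) = 0"
  using skew_weights_sign[OF assms(1) assms(2) assms(2)] by linarith

lemma mutation_term_skew:
  assumes "0 < x \<longleftrightarrow> x' < 0" "x < 0 \<longleftrightarrow> 0 < x'" "0 < y \<longleftrightarrow> y' < 0" "y < 0 \<longleftrightarrow> 0 < y'"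
    and "x * y * d = y' * x' * e"
  shows "mutation_term x y * d = - (mutation_term y' x' * e)"
proof (cases "0 < x \<and> 0 < y \<or> x < 0 \<and> y < 0")
  case True
  then show ?thesis
  proof
    assume "0 < x \<and> 0 < y"
    then show ?thesis using assms(1,3) assms(5) by (simp add: mutation_term_def)
  next
    assume "x < 0 \<and> y < 0"
    then show ?thesis using assms(2,4) assms(5) by (simp add: mutation_term_def)
  qed
next
  case False
  then have "mutation_term x y = 0" "mutation_term y' x' = 0"
    using assms(1-4) by (auto simp: mutation_term_def)
  then show ?thesis by simp
qed

lemma skew_weights_mutate_mat:
  assumes B: "skew_weights d B" "B \<in> carrier_mat n n" and k: "k < n"
  shows "skew_weights d (mutate_mat B k)"
proof -
  have n: "dim_row B = n" "dim_col B = n" using B by auto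
  have s: "B $$ (i, j) * d j = - (B $$ (j, i) * d i)" if "i < n" "j < n" for i j
    using B(1) that unfolding skew_weights_def n by blast
  have sg: "B $$ (i, j) > 0 \<longleftrightarrow> B $$ (j, i) < 0" if "i < n" "j < n" for i j
    using skew_weights_sign[OF B(1)] that n by auto
  \<comment> \<open>The weight passes from \<open>j\<close> to \<open>k\<close> and from
    \<open>k\<close> to \<open>i\<close>; the two minus signs cancel.\<close>
  have *: "B $$ (i, k) * B $$ (k, j) * d j = B $$ (j, k) * B $$ (k, i) * d i"
    if "i < n" "j < n" for i j
  proof -
    have "B $$ (i, k) * B $$ (k, j) * d j = - (B $$ (i, k) * d k) * B $$ (j, k)"
      using s[of k j] that k by (simp add: mult.assoc)
    also have "\<dots> = B $$ (k, i) * d i * B $$ (j, k)"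
      using s[of i k] that k by simp
    finally show ?thesis by (simp add: ac_simps)
  qed
  have t: "mutation_term (B $$ (i, k)) (B $$ (k, j)) * d j
      = - (mutation_term (B $$ (j, k)) (B $$ (k, i)) * d i)" if "i < n" "j < n" for i j
    using *[OF that] sg that k by (intro mutation_term_skew) auto
  have "mutate_mat B k $$ (i, j) * d j = - (mutate_mat B k $$ (j, i) * d i)"
    if "i < n" "j < n" for i j
    using s[OF that] t[OF that] that n by (simp add: mutate_mat_eq distrib_right)
  then show ?thesis
    using B(1) unfolding skew_weights_def dim_mutate_mat n by blast
qed

section \<open>Tropical mutation and its invertibility\<close>

type_synonym tropical_seed = "int vec \<times> int mat"

definition mutate_tropical :: "tropical_seed \<Rightarrow> nat \<Rightarrow> tropical_seed" where
  "mutate_tropical s k = (case s of (t, B) \<Rightarrow>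
     (vec (dim_vec t) (\<lambda>i. if i = k
        then max (\<Sum>i<dim_vec t. max (B $$ (i, k)) 0 * t $ i)
                 (\<Sum>i<dim_vec t. max (- B $$ (i, k)) 0 * t $ i) - t $ k
        else t $ i), mutate_mat B k))"

lemma mutate_tropical_snd [simp]: "snd (mutate_tropical s k) = mutate_mat (snd s) k"
  by (simp add: mutate_tropical_def split: prod.split)

lemma mutate_tropical_dim [simp]: "dim_vec (fst (mutate_tropical s k)) = dim_vec (fst s)"
  by (simp add: mutate_tropical_def split: prod.split)

lemma foldl_mutate_tropical_snd [simp]:
  "snd (foldl mutate_tropical s w) = foldl mutate_mat (snd s) w"
  by (induction w rule: rev_induct) auto

lemma foldl_mutate_tropical_dim [simp]:
  "dim_vec (fst (foldl mutate_tropical s w)) = dim_vec (fst s)"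
  by (induction w rule: rev_induct) auto

text \<open>As \<open>B $$ (k, k) = 0\<close>, neither sum involves coordinate \<open>k\<close>.
  After the mutation column \<open>k\<close> has opposite signs, so the sums trade places and their
  maximum is the same.\<close>

lemma mutate_tropical_mutate_tropical:
  assumes "skew_weights d B" "B \<in> carrier_mat n n" "k < n" "dim_vec t = n"
  shows "mutate_tropical (mutate_tropical (t, B) k) k = (t, B)"
proof -
  have kk: "B $$ (k, k) = 0" using skew_weights_diag[OF assms(1)] assms(2,3) by auto
  define f where "f i = (if i = k
        then max (\<Sum>i<n. max (B $$ (i, k)) 0 * t $ i)
                 (\<Sum>i<n. max (- B $$ (i, k)) 0 * t $ i) - t $ k
        else t $ i)" for i
  have m: "mutate_tropical (t, B) k = (vec n f, mutate_mat B k)"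
    using assms by (auto simp: mutate_tropical_def f_def)
  have col: "mutate_mat B k $$ (i, k) = - B $$ (i, k)" if "i < n" for i
    using that assms by (auto simp: mutate_mat_def)
  have 1: "(\<Sum>i<n. max (mutate_mat B k $$ (i, k)) 0 * vec n f $ i)
      = (\<Sum>i<n. max (- B $$ (i, k)) 0 * t $ i)"
    by (intro sum.cong) (auto simp: col kk f_def)
  have 2: "(\<Sum>i<n. max (- mutate_mat B k $$ (i, k)) 0 * vec n f $ i)
      = (\<Sum>i<n. max (B $$ (i, k)) 0 * t $ i)"
    by (intro sum.cong) (auto simp: col kk f_def)
  show ?thesis
    unfolding m unfolding mutate_tropical_def prod.case dim_vec unfolding 1 2
    using assms by (intro prod_eqI eq_vecI) (auto simp: f_def mutate_mat_mutate_mat max.commute)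
qed

lemma foldl_mutate_tropical_inverse:
  assumes "skew_weights d B" "B \<in> carrier_mat n n" "set w \<subseteq> {..<n}" "dim_vec t = n"
  shows "foldl mutate_tropical (foldl mutate_tropical (t, B) w) (rev w) = (t, B)"
  using assms
proof (induction w arbitrary: t B)
  case (Cons k w)
  obtain t' B' where m: "mutate_tropical (t, B) k = (t', B')" by fastforce
  with Cons.prems have "dim_vec t' = n" "B' = mutate_mat B k"
    using mutate_tropical_dim[of "(t, B)" k] mutate_tropical_snd[of "(t, B)" k] by auto
  with Cons have "foldl mutate_tropical (foldl mutate_tropical (t', B') w) (rev w) = (t', B')"
    by (intro Cons.IH) (auto intro: skew_weights_mutate_mat)
  moreover have "mutate_tropical (t', B') k = (t, B)"
    using mutate_tropical_mutate_tropical[of d B n k t] Cons.prems m by simp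
  ultimately show ?case
    using m by simp
qed simp

section \<open>Evaluating seeds\<close>

lemma mutate_seed_snd [simp]: "snd (mutate_seed s k) = mutate_mat (snd s) k"
  by (simp add: mutate_seed_def split: prod.split)

lemma mutate_seed_dim [simp]: "dim_vec (fst (mutate_seed s k)) = dim_vec (fst s)"
  by (simp add: mutate_seed_def split: prod.split)

lemma foldl_mutate_seed_snd [simp]: "snd (foldl mutate_seed s w) = foldl mutate_mat (snd s) w"
  by (induction w rule: rev_induct) auto

lemma foldl_mutate_seed_dim [simp]: "dim_vec (fst (foldl mutate_seed s w)) = dim_vec (fst s)"
  by (induction w rule: rev_induct) auto

definition tropicalizes :: "int vec \<Rightarrow> seed \<Rightarrow> tropical_seed \<Rightarrow> bool" where
  "tropicalizes a s \<tau> \<longleftrightarrow> snd s = snd \<tau> \<and> dim_vec (fst s) = dim_vec (fst \<tau>) \<and>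
     (\<forall>i < dim_vec (fst s). tropical_value a (fst s $ i) (fst \<tau> $ i))"

lemma tropical_value_exchange_monomial:
  assumes "\<And>i. i < n \<Longrightarrow> tropical_value a (x i) (t i)"
  shows "tropical_value a (\<Prod>i<n. x i ^ nat (max (f i) 0)) (\<Sum>i<n. max (f i) 0 * t i)"
proof -
  have "tropical_value a (\<Prod>i<n. x i ^ nat (max (f i) 0)) (\<Sum>i<n. int (nat (max (f i) 0)) * t i)"
    using assms by (intro tropical_value_prod tropical_value_power) auto
  then show ?thesis by simp
qed

lemma tropicalizes_mutate:
  assumes "tropicalizes a s \<tau>" "k < dim_vec (fst s)"
  shows "tropicalizes a (mutate_seed s k) (mutate_tropical \<tau> k)"
proof -
  obtain x B t where s: "s = (x, B)" "\<tau> = (t, B)"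
    using assms by (cases s; cases \<tau>) (auto simp: tropicalizes_def)
  let ?n = "dim_vec x"
  have t: "dim_vec t = ?n" "\<And>i. i < ?n \<Longrightarrow> tropical_value a (x $ i) (t $ i)"
    using assms s by (auto simp: tropicalizes_def)
  have "tropical_value a (exchanged_var (x, B) k)
    (max (\<Sum>i<?n. max (B $$ (i, k)) 0 * t $ i) (\<Sum>i<?n. max (- B $$ (i, k)) 0 * t $ i) - t $ k)"
    unfolding exchanged_var_def prod.case using assms(2) s(1) t(2)
    by (intro tropical_value_divide tropical_value_add tropical_value_exchange_monomial) auto
  then show ?thesis
    using t by (auto simp: tropicalizes_def s mutate_seed_def mutate_tropical_def)
qed

lemma tropicalizes_foldl:
  assumes "tropicalizes a s \<tau>" "set w \<subseteq> {..<dim_vec (fst s)}"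
  shows "tropicalizes a (foldl mutate_seed s w) (foldl mutate_tropical \<tau> w)"
  using assms(2)
  by (induction w rule: rev_induct) (auto simp: assms(1) intro: tropicalizes_mutate)

lemma tropicalizes_initial_seed:
  "dim_vec a = dim_row B \<Longrightarrow> tropicalizes a (initial_seed B) (a, B)"
  by (simp add: tropicalizes_def initial_seed_def tropical_value_var)

lemma tropicalizes_seed_at:
  assumes "dim_vec a = dim_row B" "set w \<subseteq> {..<dim_row B}"
  shows "tropicalizes a (seed_at B w) (foldl mutate_tropical (a, B) w)"
  unfolding seed_at_def
  using assms by (intro tropicalizes_foldl tropicalizes_initial_seed) (auto simp: initial_seed_def)

text \<open>The left side mentions the cluster only as a set, the right side only integers computed
  along the path: this is the invariant that tells clusters apart.\<close>

lemma tropical_values_of_cluster: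
  assumes "dim_vec a = dim_row B" "set w \<subseteq> {..<dim_row B}"
  shows "{t. \<exists>x \<in> cluster_at B w. tropical_value a x t}
    = vec_set (fst (foldl mutate_tropical (a, B) w))"
proof -
  let ?x = "fst (seed_at B w)" and ?t = "fst (foldl mutate_tropical (a, B) w)"
  have "tropical_value a (?x $ i) u \<longleftrightarrow> u = ?t $ i" if "i < dim_vec ?x" for i u
    using tropicalizes_seed_at[OF assms] that tropical_value_unique[of a "?x $ i"]
    unfolding tropicalizes_def by blast
  moreover have "dim_vec ?t = dim_vec ?x"
    using tropicalizes_seed_at[OF assms] by (simp add: tropicalizes_def)
  ultimately show ?thesis
    by (auto simp: cluster_at_def vec_set_def image_iff Bex_def)
qed

text \<open>Undoing the division requires \<open>x $ k\<close> and the sum of the two exchange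
  monomials to be nonzero. Both have a tropical value, which zero has not.\<close>

lemma mutate_seed_mutate_seed:
  assumes "tropicalizes a s \<tau>" "snd s \<in> carrier_mat n n" "dim_vec (fst s) = n"
    "skew_weights d (snd s)" "k < n"
  shows "mutate_seed (mutate_seed s k) k = s"
proof -
  obtain x B where s: "s = (x, B)" by fastforce
  have kk: "B $$ (k, k) = 0" using skew_weights_diag[OF assms(4)] assms s by auto
  have n: "dim_vec x = n" using assms s by simp
  define N where "N y = (\<Prod>i<n. (y i) ^ nat (max (B $$ (i, k)) 0)) +
      (\<Prod>i<n. (y i) ^ nat (max (- B $$ (i, k)) 0))" for y :: "nat \<Rightarrow> ratfun"
  have e: "exchanged_var (x, B) k = N (($) x) / x $ k"
    by (simp add: exchanged_var_def N_def n)
  have x: "tropical_value a (x $ i) (fst \<tau> $ i)" if "i < n" for i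
    using assms s that by (auto simp: tropicalizes_def)
  have "tropical_value a (N (($) x)) (max (\<Sum>i<n. max (B $$ (i, k)) 0 * fst \<tau> $ i)
      (\<Sum>i<n. max (- B $$ (i, k)) 0 * fst \<tau> $ i))"
    unfolding N_def using x by (intro tropical_value_add tropical_value_exchange_monomial)
  then have N0: "N (($) x) \<noteq> 0" by (rule tropical_value_nonzero)
  have xk: "x $ k \<noteq> 0" using x assms(5) tropical_value_nonzero by blast
  define y where "y = vec n (\<lambda>i. if i = k then N (($) x) / x $ k else x $ i)"
  have m: "mutate_seed s k = (y, mutate_mat B k)"
    unfolding s mutate_seed_def prod.case n e y_def by simp
  have col: "mutate_mat B k $$ (i, k) = - B $$ (i, k)" if "i < n" for i
    using that assms s by (auto simp: mutate_mat_def)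
  have "exchanged_var (y, mutate_mat B k) k = N (($) x) / y $ k"
    unfolding exchanged_var_def N_def prod.case
    by (subst add.commute, intro arg_cong2[where f = "(/)"] arg_cong2[where f = "(+)"] prod.cong)
      (auto simp: y_def col kk)
  then have xk': "exchanged_var (y, mutate_mat B k) k = x $ k"
    using N0 xk assms(5) by (simp add: y_def)
  have "mutate_mat (mutate_mat B k) k = B"
    using assms s by (auto intro: mutate_mat_mutate_mat)
  then show ?thesis
    unfolding m unfolding mutate_seed_def prod.case xk' using s n by (auto simp: y_def)
qed

section \<open>Distinct clusters bound the growth from below\<close>

lemma foldl_skew_weights:
  "skew_weights d B \<Longrightarrow> B \<in> carrier_mat n n \<Longrightarrow> set w \<subseteq> {..<n} \<Longrightarrow>
    skew_weights d (foldl mutate_mat B w)"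
  by (induction w rule: rev_induct) (auto intro: skew_weights_mutate_mat[where n = n])

lemma seed_at_snoc: "seed_at B (w @ [k]) = mutate_seed (seed_at B w) k"
  by (simp add: seed_at_def)

lemma seed_at_backtrack:
  assumes "skew_symmetrizable B" "set w \<subseteq> {..<dim_row B}" "k < dim_row B"
  shows "seed_at B (w @ [k, k]) = seed_at B w"
proof -
  obtain d where d: "skew_weights d B"
    using assms(1) by (rule skew_symmetrizable_imp_skew_weights)
  have B: "B \<in> carrier_mat (dim_row B) (dim_row B)"
    using assms(1) by (auto simp: skew_symmetrizable_def)
  \<comment> \<open>Any evaluation point would do; the values are wanted only to keep the cluster
    variables nonzero.\<close>
  have "tropicalizes (0\<^sub>v (dim_row B)) (seed_at B w) (foldl mutate_tropical (0\<^sub>v (dim_row B), B) w)"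
    using assms by (intro tropicalizes_seed_at) auto
  moreover have "snd (seed_at B w) = foldl mutate_mat B w" "dim_vec (fst (seed_at B w)) = dim_row B"
    by (auto simp: seed_at_def initial_seed_def)
  ultimately have "mutate_seed (mutate_seed (seed_at B w) k) k = seed_at B w"
    using foldl_skew_weights[OF d B assms(2)] foldl_mutate_mat_carrier[OF B] assms(3)
    by (intro mutate_seed_mutate_seed[where n = "dim_row B"]) auto
  then show ?thesis
    using seed_at_snoc[of B "w @ [k]" k] by (simp add: seed_at_snoc)
qed

text \<open>Words concatenated from mutation sequences may repeat a letter at a junction, whereas
  the vertices of the tree are non-backtracking. Cancelling a repeated letter keeps the seed and
  does not lengthen the word.\<close>

lemma reduced_word_exists:
  assumes "skew_symmetrizable B" "set w \<subseteq> {..<dim_row B}"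
  shows "\<exists>w' \<in> tree_verts (dim_row B). length w' \<le> length w \<and> seed_at B w' = seed_at B w"
  using assms(2)
proof (induction w rule: rev_induct)
  case Nil
  show ?case by (auto simp: tree_verts_def)
next
  case (snoc k w)
  then obtain w' where w': "w' \<in> tree_verts (dim_row B)" "length w' \<le> length w"
      "seed_at B w' = seed_at B w"
    by auto
  show ?case
  proof (cases "w' \<noteq> [] \<and> last w' = k")
    case True
    then obtain u where u: "w' = u @ [k]" by (metis append_butlast_last_id)
    have "seed_at B u = seed_at B (u @ [k, k])"
      using seed_at_backtrack[OF assms(1), of u k] w'(1) u snoc.prems by (auto simp: tree_verts_def)
    also have "\<dots> = seed_at B (w @ [k])"
      using seed_at_snoc[of B "u @ [k]" k] w'(3) u by (simp add: seed_at_snoc)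
    finally have "seed_at B u = seed_at B (w @ [k])" .
    moreover have "u \<in> tree_verts (dim_row B)"
      using w'(1) u by (auto simp: tree_verts_def distinct_adj_append_iff)
    ultimately show ?thesis using w'(2) u by (intro bexI[of _ u]) auto
  next
    case False
    then have "w' @ [k] \<in> tree_verts (dim_row B)"
      using w'(1) snoc.prems by (auto simp: tree_verts_def distinct_adj_append_iff)
    then show ?thesis
      using w' by (intro bexI[of _ "w' @ [k]"]) (auto simp: seed_at_snoc)
  qed
qed

lemma exchange_path:
  assumes "w \<in> tree_verts (dim_row B)"
  shows "(exchange_root B, same_cluster B `` {w}) \<in> exchange_edges B ^^ length w"
  using assms
proof (induction w rule: rev_induct)
  case Nil
  show ?case by (simp add: exchange_root_def)
next
  case (snoc k w)
  then have "w \<in> tree_verts (dim_row B)"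
    by (auto simp: tree_verts_def distinct_adj_append_iff)
  moreover from this snoc.prems have "(w, w @ [k]) \<in> tree_edges (dim_row B)"
    by (auto simp: tree_edges_def)
  then have "(same_cluster B `` {w}, same_cluster B `` {w @ [k]}) \<in> exchange_edges B"
    by (auto simp: exchange_edges_def)
  ultimately show ?case
    using snoc.IH by auto
qed

lemma graph_dist_exchange_root:
  assumes "w \<in> tree_verts (dim_row B)"
  shows "graph_dist (exchange_edges B) (exchange_root B) (same_cluster B `` {w}) \<le> enat (length w)"
  unfolding graph_dist_def using exchange_path[OF assms] by (intro INF_lower) simp

lemma same_cluster_clusterD: "(w, w') \<in> same_cluster B \<Longrightarrow> cluster_at B w = cluster_at B w'"
  by (simp add: same_cluster_def)

text \<open>Every cluster reached by a word of \<open>W\<close> is the cluster of some vertex in the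
  ball of radius \<open>N\<close>. An infinite ball is immediate, since its size is then infinite by
  definition of \<open>num_elems\<close>.\<close>

lemma growth_fun_ge:
  assumes B: "skew_symmetrizable B"
    and W: "\<And>w. w \<in> W \<Longrightarrow> set w \<subseteq> {..<dim_row B} \<and> length w \<le> N"
  shows "enat (card (cluster_at B ` W)) \<le> growth_fun B N"
proof -
  define V where "V = {v \<in> exchange_verts B.
     graph_dist (exchange_edges B) (exchange_root B) v \<le> enat N}"
  \<comment> \<open>All members of a vertex have the same cluster, so the choice of a representative
    is harmless.\<close>
  define cl where "cl v = cluster_at B (SOME w. w \<in> v)" for v
  have "cluster_at B w \<in> cl ` V" if w: "w \<in> W" for w
  proof -
    obtain w' where w': "w' \<in> tree_verts (dim_row B)" "length w' \<le> length w"
      "seed_at B w' = seed_at B w"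
      using reduced_word_exists[OF B] W[OF w] by blast
    let ?v = "same_cluster B `` {w'}"
    have "w' \<in> ?v" using w'(1) by (auto simp: same_cluster_def)
    then have "(SOME u. u \<in> ?v) \<in> ?v" by (rule someI)
    then have "(w', SOME u. u \<in> ?v) \<in> same_cluster B" by (rule Image_singleton_iff[THEN iffD1])
    then have "cl ?v = cluster_at B w'" unfolding cl_def by (rule same_cluster_clusterD[symmetric])
    moreover have "graph_dist (exchange_edges B) (exchange_root B) ?v \<le> enat N"
      using graph_dist_exchange_root[OF w'(1)] w'(2) W[OF w]
      by (meson enat_ord_simps(1) order_trans)
    then have "?v \<in> V" using w'(1) by (auto simp: V_def exchange_verts_def quotient_def)
    ultimately show ?thesis using w'(3) by (auto simp: cluster_at_def intro!: image_eqI[of _ _ ?v])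
  qed
  then have "card (cluster_at B ` W) \<le> card V" if "finite V"
    using that by (meson card_image_le card_mono finite_imageI image_subsetI order_trans)
  then show ?thesis
    unfolding growth_fun_def V_def[symmetric] num_elems_def by auto
qed

lemma exponential_growthI:
  fixes W :: "nat \<Rightarrow> nat list set"
  assumes B: "skew_symmetrizable B" and L: "0 < L" and \<kappa>: "0 < \<kappa>"
    and W: "\<And>m w. w \<in> W m \<Longrightarrow> set w \<subseteq> {..<dim_row B} \<and> length w \<le> a + m * L"
    and count: "\<And>m. 2 ^ m \<le> \<kappa> * card (cluster_at B ` W m)"
  shows "exponential_growth B"
proof -
  \<comment> \<open>With this base about \<open>N / (2 * L)\<close> blocks suffice for the count.
    They use half of the length \<open>N\<close>; the other half pays for the prefix
    \<open>a\<close>, the rounding in \<open>j\<close> and \<open>\<kappa>\<close> extra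
    blocks.\<close>
  define c :: real where "c = root (2 * L) 2"
  have c: "1 < c" "c ^ (2 * L) = 2"
    using L by (auto simp: c_def real_root_gt_1_iff)
  have "ereal (c ^ N) \<le> ereal_of_enat (growth_fun B N)" if N: "2 * (a + L * (1 + \<kappa>)) \<le> N" for N
  proof -
    define j where "j = N div (2 * L) + 1"
    have "L * (N div (2 * L)) * 2 \<le> N"
      using div_times_less_eq_dividend[of N "2 * L"] by (simp add: ac_simps)
    then have len: "a + (j + \<kappa>) * L \<le> N"
      using N by (simp add: j_def algebra_simps)
    have "N \<le> 2 * L * j"
      using L dividend_less_times_div[of "2 * L" N] by (simp add: j_def)
    then have "c ^ N \<le> c ^ (2 * L * j)"
      using c(1) by (intro power_increasing) auto
    also have "\<dots> = 2 ^ j" by (subst power_mult) (simp only: c(2))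
    finally have cN: "c ^ N \<le> 2 ^ j" .
    \<comment> \<open>Since \<open>\<kappa> < 2 ^ \<kappa>\<close>, taking \<open>\<kappa>\<close>
      more blocks absorbs the factor \<open>\<kappa>\<close> lost in \<open>count\<close>.\<close>
    have "2 ^ j * \<kappa> \<le> (2::nat) ^ (j + \<kappa>)"
      by (simp add: power_add less_imp_le)
    also have "\<dots> \<le> \<kappa> * card (cluster_at B ` W (j + \<kappa>))" by (rule count)
    finally have "2 ^ j \<le> card (cluster_at B ` W (j + \<kappa>))"
      using \<kappa> by (simp add: mult.commute)
    then have "(2::real) ^ j \<le> real (card (cluster_at B ` W (j + \<kappa>)))"
      by (metis of_nat_le_iff of_nat_numeral of_nat_power)
    with cN have "c ^ N \<le> real (card (cluster_at B ` W (j + \<kappa>)))" by (rule order_trans)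
    then have "ereal (c ^ N) \<le> ereal_of_enat (enat (card (cluster_at B ` W (j + \<kappa>))))"
      by simp
    also have "\<dots> \<le> ereal_of_enat (growth_fun B N)"
      using W[of _ "j + \<kappa>"] len unfolding ereal_of_enat_le_iff
      by (intro growth_fun_ge[OF B]) fastforce
    finally show ?thesis .
  qed
  then show ?thesis
    unfolding exponential_growth_def eventually_sequentially using c(1) by blast
qed

section \<open>Tropical ping-pong\<close>

text \<open>Linearity is demanded on the whole cone, because the images of \<open>p\<close> and
  \<open>q\<close> alone do not determine a piecewise linear map between them.\<close>

definition is_twist :: "int mat \<Rightarrow> nat list \<Rightarrow> int vec \<Rightarrow> int vec \<Rightarrow> int \<Rightarrow> bool" where
  "is_twist B w p q k \<longleftrightarrow> set w \<subseteq> {..<dim_row B} \<and> 0 < k \<and>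
     (\<forall>\<alpha> \<ge> 0. \<forall>\<beta> \<ge> 0. foldl mutate_tropical (\<alpha> \<cdot>\<^sub>v p + \<beta> \<cdot>\<^sub>v q, B) w = ((\<alpha> + k * \<beta>) \<cdot>\<^sub>v p + \<beta> \<cdot>\<^sub>v q, B))"

text \<open>The nonzero minor says that \<open>p\<close> and \<open>q\<close> are independent and
  names two coordinates from which both coefficients of a combination can be recovered.\<close>

definition ping_pong :: "int mat \<Rightarrow> bool" where
  "ping_pong B \<longleftrightarrow> (\<exists>u v p q k l i j. is_twist B u p q k \<and> is_twist B v q p l \<and>
     p \<in> carrier_vec (dim_row B) \<and> q \<in> carrier_vec (dim_row B) \<and>
     i < dim_row B \<and> j < dim_row B \<and> p $ i * q $ j \<noteq> p $ j * q $ i)"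

definition shear :: "int \<Rightarrow> int \<Rightarrow> int \<times> int \<Rightarrow> bool \<Rightarrow> int \<times> int" where
  "shear k l c b = (if b then (fst c + k * snd c, snd c) else (fst c, snd c + l * fst c))"

lemma shear_cancel: "shear k l c b = shear k l c' b \<Longrightarrow> c = c'"
  by (auto simp: shear_def prod_eq_iff split: if_splits)

lemma foldl_shear_pos:
  assumes "0 < k" "0 < l"
  shows "0 < fst (foldl (shear k l) (1, 1) bs) \<and> 0 < snd (foldl (shear k l) (1, 1) bs)"
  using assms by (induction bs rule: rev_induct) (auto simp: shear_def add_pos_pos)

text \<open>The last shear can be read off from which of the two coordinates is larger.\<close>

lemma inj_foldl_shear:
  assumes k: "0 < k" and l: "0 < l"
  shows "inj (foldl (shear k l) (1, 1))"
proof -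
  let ?F = "foldl (shear k l) (1, 1)"
  have ne: "fst (?F (bs @ [b])) < snd (?F (bs @ [b])) \<longleftrightarrow> \<not> b"
    "fst (?F (bs @ [b])) \<noteq> snd (?F (bs @ [b]))" for bs b
  proof -
    obtain x y where F: "?F bs = (x, y)" by fastforce
    have pos: "0 < x" "0 < y" using foldl_shear_pos[OF k l, of bs] F by auto
    have le: "y \<le> k * y" "x \<le> l * x" using k l pos by simp_all
    have step: "?F (bs @ [b]) = (if b then (x + k * y, y) else (x, y + l * x))"
      by (simp add: F shear_def)
    have lt: "\<not> x + k * y < y" "x + k * y \<noteq> y" "x < y + l * x" "x \<noteq> y + l * x"
      using pos le by linarith+
    show "fst (?F (bs @ [b])) < snd (?F (bs @ [b])) \<longleftrightarrow> \<not> b"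
      unfolding step by (cases b) (simp_all only: if_True if_False fst_conv snd_conv lt simp_thms)
    show "fst (?F (bs @ [b])) \<noteq> snd (?F (bs @ [b]))"
      unfolding step by (cases b) (simp_all only: if_True if_False fst_conv snd_conv lt simp_thms)
  qed
  have "bs = bs'" if "?F bs = ?F bs'" for bs bs'
    using that
  proof (induction bs arbitrary: bs' rule: rev_induct)
    \<comment> \<open>The start \<open>(1, 1)\<close> has equal coordinates, which no nonempty word
      produces.\<close>
    case Nil
    then show ?case
      using ne(2)[of "butlast bs'" "last bs'"] by (cases "bs' = []") auto
  next
    case (snoc b bs)
    then have "bs' \<noteq> []" using ne(2)[of bs b] by auto
    then obtain cs c where bs': "bs' = cs @ [c]" by (metis append_butlast_last_id)
    with snoc.prems have "b = c" using ne(1)[of bs b] ne(1)[of cs c] by simp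
    moreover have "?F bs = ?F cs"
      using snoc.prems unfolding bs' \<open>b = c\<close> by (auto intro: shear_cancel)
    ultimately show ?case using snoc.IH bs' by blast
  qed
  then show ?thesis by (rule injI)
qed

text \<open>Both coefficients stay positive, so the orbit of \<open>p + q\<close> never leaves the
  cone on which the twists are linear.\<close>

lemma foldl_mutate_tropical_ping_pong:
  assumes u: "is_twist B u p q k" and v: "is_twist B v q p l"
    and p: "p \<in> carrier_vec n" and q: "q \<in> carrier_vec n"
  shows "foldl mutate_tropical (1 \<cdot>\<^sub>v p + 1 \<cdot>\<^sub>v q, B) (concat (map (\<lambda>b. if b then u else v) bs)) =
    (fst (foldl (shear k l) (1, 1) bs) \<cdot>\<^sub>v p + snd (foldl (shear k l) (1, 1) bs) \<cdot>\<^sub>v q, B)"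
proof (induction bs rule: rev_induct)
  case Nil
  show ?case by simp
next
  case (snoc b bs)
  obtain \<alpha> \<beta> where F: "foldl (shear k l) (1, 1) bs = (\<alpha>, \<beta>)" by fastforce
  have "0 < k" "0 < l" using u v by (auto simp: is_twist_def)
  then have pos: "0 \<le> \<alpha>" "0 \<le> \<beta>" using foldl_shear_pos[of k l bs] F by auto
  have u': "foldl mutate_tropical (\<alpha> \<cdot>\<^sub>v p + \<beta> \<cdot>\<^sub>v q, B) u = ((\<alpha> + k * \<beta>) \<cdot>\<^sub>v p + \<beta> \<cdot>\<^sub>v q, B)"
    using u pos by (simp add: is_twist_def)
  have "foldl mutate_tropical (\<beta> \<cdot>\<^sub>v q + \<alpha> \<cdot>\<^sub>v p, B) v = ((\<beta> + l * \<alpha>) \<cdot>\<^sub>v q + \<alpha> \<cdot>\<^sub>v p, B)"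
    using v pos by (simp add: is_twist_def)
  moreover have "x \<cdot>\<^sub>v q + y \<cdot>\<^sub>v p = y \<cdot>\<^sub>v p + x \<cdot>\<^sub>v q" for x y
    using p q by (intro comm_add_vec) auto
  ultimately have v': "foldl mutate_tropical (\<alpha> \<cdot>\<^sub>v p + \<beta> \<cdot>\<^sub>v q, B) v = (\<alpha> \<cdot>\<^sub>v p + (\<beta> + l * \<alpha>) \<cdot>\<^sub>v q, B)"
    by simp
  have step: "foldl (shear k l) (1, 1) (bs @ [b]) = shear k l (\<alpha>, \<beta>) b" by (simp add: F)
  show ?case
    unfolding step using snoc.IH u' v' unfolding F by (cases b) (simp_all add: shear_def)
qed

text \<open>Cramer's rule for the minor at the coordinates \<open>i\<close> and
  \<open>j\<close>.\<close>

lemma two_coordinates_determine_coefficients: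
  assumes pq: "p $ i * q $ j \<noteq> p $ j * q $ i"
    and "\<alpha> * p $ i + \<beta> * q $ i = \<alpha>' * p $ i + \<beta>' * q $ i"
    and "\<alpha> * p $ j + \<beta> * q $ j = \<alpha>' * p $ j + \<beta>' * (q $ j :: int)"
  shows "\<alpha> = \<alpha>' \<and> \<beta> = \<beta>'"
proof -
  have "(\<alpha> - \<alpha>') * (p $ i * q $ j - p $ j * q $ i) =
      ((\<alpha> - \<alpha>') * p $ i + (\<beta> - \<beta>') * q $ i) * q $ j - ((\<alpha> - \<alpha>') * p $ j + (\<beta> - \<beta>') * q $ j) * q $ i"
    by (simp add: algebra_simps)
  also have "\<dots> = 0" using assms(2,3) by (simp add: algebra_simps)
  finally have "\<alpha> = \<alpha>'" using pq by simp
  have "(\<beta> - \<beta>') * (p $ i * q $ j - p $ j * q $ i) =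
      ((\<alpha> - \<alpha>') * p $ j + (\<beta> - \<beta>') * q $ j) * p $ i - ((\<alpha> - \<alpha>') * p $ i + (\<beta> - \<beta>') * q $ i) * p $ j"
    by (simp add: algebra_simps)
  also have "\<dots> = 0" using assms(2,3) by (simp add: algebra_simps)
  finally have "\<beta> = \<beta>'" using pq by simp
  with \<open>\<alpha> = \<alpha>'\<close> show ?thesis by simp
qed

lemma foldl_mutate_mat_inverse:
  assumes "B \<in> carrier_mat n n" "set w \<subseteq> {..<n}"
  shows "foldl mutate_mat (foldl mutate_mat B w) (rev w) = B"
  using assms by (induction w arbitrary: B) (auto simp: mutate_mat_mutate_mat)

theorem ping_pong_exponential_growth:
  assumes B: "skew_symmetrizable B" and ks: "set ks \<subseteq> {..<dim_row B}"
    and pp: "ping_pong (foldl mutate_mat B ks)"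
  shows "exponential_growth B"
proof -
  define n where "n = dim_row B"
  define B' where "B' = foldl mutate_mat B ks"
  have Bn: "B \<in> carrier_mat n n" using B by (auto simp: skew_symmetrizable_def n_def)
  then have B'n: "B' \<in> carrier_mat n n" by (simp add: B'_def)
  obtain u v p q k l i j where u: "is_twist B' u p q k" and v: "is_twist B' v q p l"
    and p: "p \<in> carrier_vec n" and q: "q \<in> carrier_vec n"
    and ij: "i < n" "j < n" "p $ i * q $ j \<noteq> p $ j * q $ i"
    using pp B'n unfolding ping_pong_def B'_def[symmetric] by auto
  have uv: "set u \<subseteq> {..<n}" "set v \<subseteq> {..<n}" "0 < k" "0 < l"
    using u v B'n by (auto simp: is_twist_def)
  define t where "t = 1 \<cdot>\<^sub>v p + 1 \<cdot>\<^sub>v q"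
  \<comment> \<open>The point at the initial seed that \<open>ks\<close> carries to
    \<open>p + q\<close>, found by running backwards.\<close>
  define a where "a = fst (foldl mutate_tropical (t, B') (rev ks))"
  obtain d where d: "skew_weights d B" using B by (rule skew_symmetrizable_imp_skew_weights)
  have t: "dim_vec t = n" using p q by (simp add: t_def)
  have a: "dim_vec a = n" by (simp add: a_def t)
  have "foldl mutate_tropical (t, B') (rev ks) = (a, B)"
    using foldl_mutate_mat_inverse[OF Bn] ks by (simp add: a_def prod_eq_iff B'_def n_def)
  moreover have "skew_weights d B'"
    unfolding B'_def using foldl_skew_weights[OF d Bn] ks by (simp add: n_def)
  ultimately have aks: "foldl mutate_tropical (a, B) ks = (t, B')"
    using foldl_mutate_tropical_inverse[of d B' n "rev ks" t] B'n t ks by (simp add: n_def)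

  define word where "word bs = concat (map (\<lambda>b. if b then u else v) bs)" for bs
  define path where "path bs = ks @ word bs" for bs
  define co where "co bs = foldl (shear k l) (1, 1) bs" for bs
  define val where "val bs = fst (co bs) \<cdot>\<^sub>v p + snd (co bs) \<cdot>\<^sub>v q" for bs
  have path: "set (path bs) \<subseteq> {..<n}" for bs
    using ks uv by (auto simp: path_def word_def n_def split: if_splits)
  have val_dim: "dim_vec (val bs) = n" for bs using p q by (simp add: val_def)
  have val_nth: "val bs $ r = fst (co bs) * p $ r + snd (co bs) * q $ r" if "r < n" for bs r
    using that p q by (simp add: val_def)
  have "foldl mutate_tropical (a, B) (path bs) = (val bs, B')" for bs
    using foldl_mutate_tropical_ping_pong[OF u v p q, of bs]
    by (simp add: path_def aks word_def val_def co_def t_def)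
  then have cluster: "{t. \<exists>x \<in> cluster_at B (path bs). tropical_value a x t} = vec_set (val bs)" for bs
    using tropical_values_of_cluster[of a B "path bs"] a path[of bs] by (simp add: n_def)
  define val_set where "val_set C = {t. \<exists>x \<in> C. tropical_value a x t}" for C
  \<comment> \<open>Bounds the length of either block; the summand 1 makes it positive.\<close>
  define L where "L = length u + length v + 1"
  have len: "length (path bs) \<le> length ks + length bs * L" for bs
    by (induction bs) (auto simp: path_def word_def L_def algebra_simps)

  define S where "S m = {bs :: bool list. length bs = m}" for m
  have fS: "finite (S m)" "card (S m) = 2 ^ m" for m
    using card_lists_length_eq[of "UNIV :: bool set" m] finite_lists_length_eq[of "UNIV :: bool set" m]
    by (auto simp: S_def)
  have "2 ^ m \<le> n ^ 2 * card (cluster_at B ` path ` S m)" for m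
  proof -
    define K where "K = cluster_at B ` path ` S m"
    have "finite K" using fS by (simp add: K_def)
    have K: "finite (val_set C) \<and> card (val_set C) \<le> n" if "C \<in> K" for C
    proof -
      obtain bs where C: "C = cluster_at B (path bs)" using \<open>C \<in> K\<close> by (auto simp: K_def)
      have "val_set C = ($) (val bs) ` {..<n}"
        using cluster[of bs] by (simp add: C val_set_def vec_set_def val_dim)
      then show ?thesis using card_image_le[of "{..<n}" "($) (val bs)"] by simp
    qed
    \<comment> \<open>The coefficients of \<open>p\<close> and \<open>q\<close> determine the word,
      and the coordinates \<open>i\<close>, \<open>j\<close> determine the coefficients. Both
      coordinates lie in the value set of the cluster, which has at most \<open>n\<close> elements,
      so at most \<open>n ^ 2\<close> words share a cluster.\<close>
    let ?f = "\<lambda>bs. (cluster_at B (path bs), val bs $ i, val bs $ j)"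
    have "inj_on ?f (S m)"
    proof (rule inj_onI)
      fix bs bs' assume "?f bs = ?f bs'"
      then have "co bs = co bs'"
        using two_coordinates_determine_coefficients[OF ij(3), of "fst (co bs)" "snd (co bs)"
            "fst (co bs')" "snd (co bs')"] ij
        by (simp add: val_nth prod_eq_iff)
      then show "bs = bs'"
        using inj_foldl_shear[OF uv(3,4)] by (simp add: co_def inj_def)
    qed
    moreover have "val bs $ r \<in> val_set (cluster_at B (path bs))" if "r < n" for bs r
      using cluster[of bs] that val_dim[of bs] by (auto simp: val_set_def vec_set_def)
    then have "?f ` S m \<subseteq> (SIGMA C:K. val_set C \<times> val_set C)"
      using ij by (auto simp: K_def)
    moreover have "finite (SIGMA C:K. val_set C \<times> val_set C)"
      using \<open>finite K\<close> K by auto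
    ultimately have "card (S m) \<le> card (SIGMA C:K. val_set C \<times> val_set C)"
      by (rule card_inj_on_le)
    also have "\<dots> = (\<Sum>C\<in>K. card (val_set C) * card (val_set C))"
      using \<open>finite K\<close> K by (subst card_SigmaI) (auto simp: card_cartesian_product)
    also have "\<dots> \<le> (\<Sum>C\<in>K. n ^ 2)"
      unfolding power2_eq_square using K by (intro sum_mono mult_mono) auto
    finally show ?thesis by (simp add: fS K_def mult.commute)
  qed
  moreover have "set w \<subseteq> {..<dim_row B} \<and> length w \<le> length ks + m * L" if "w \<in> path ` S m" for w m
    using that path len by (auto simp: S_def n_def)
  moreover have "0 < n ^ 2" using ij by simp
  ultimately show ?thesis
    using exponential_growthI[OF B, of L "n ^ 2" "\<lambda>m. path ` S m" "length ks"] by (simp add: L_def)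
qed

section \<open>Twists verified by computation\<close>

definition rows_mat :: "int list list \<Rightarrow> int mat" where
  "rows_mat M = mat (length M) (length M) (\<lambda>(i, j). M ! i ! j)"

text \<open>A row other than row \<open>k\<close> with entry 0 in column \<open>k\<close> does not
  change; returning it untouched keeps the evaluation of long words cheap.\<close>

definition mutate_rows :: "int list list \<Rightarrow> nat \<Rightarrow> int list list" where
  "mutate_rows M k = map2 (\<lambda>i r. if i = k then map uminus r
      else let a = r ! k in if a = 0 then r
      else (map2 (\<lambda>x y. x + mutation_term a y) r (M ! k))[k := - a]) [0..<length M] M"

text \<open>The matrices along a word do not depend on the vector being mutated. Recording the
  exchange columns separately lets one list be run on every cone of a subdivision.\<close>

fun exchange_columns :: "int list list \<Rightarrow> nat list \<Rightarrow> (nat \<times> int list) list" where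
  "exchange_columns M [] = []"
| "exchange_columns M (k # w) = (k, map (\<lambda>r. r ! k) M) # exchange_columns (mutate_rows M k) w"

definition pos_part :: "int list \<Rightarrow> int list \<Rightarrow> int" where
  "pos_part c t = sum_list (map2 (\<lambda>b x. max b 0 * x) c t)"

definition neg_part :: "int list \<Rightarrow> int list \<Rightarrow> int" where
  "neg_part c t = sum_list (map2 (\<lambda>b x. max (- b) 0 * x) c t)"

fun run_vector :: "(nat \<times> int list) list \<Rightarrow> int list \<Rightarrow> int list" where
  "run_vector [] t = t"
| "run_vector ((k, c) # ss) t = run_vector ss (t[k := max (pos_part c t) (neg_part c t) - t ! k])"

text \<open>Only the spanning rays are followed. If the same side of the maximum is at least as
  large on both, it is so on the whole cone and the step is linear there; \<open>None\<close>
  reports a wall strictly between the rays.\<close>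

fun run_cone :: "(nat \<times> int list) list \<Rightarrow> int list \<times> int list \<Rightarrow> (int list \<times> int list) option" where
  "run_cone [] pq = Some pq"
| "run_cone ((k, c) # ss) (p, q) =
     (let p1 = pos_part c p; p2 = neg_part c p; q1 = pos_part c q; q2 = neg_part c q
      in if p2 \<le> p1 \<and> q2 \<le> q1 then run_cone ss (p[k := p1 - p ! k], q[k := q1 - q ! k])
      else if p1 \<le> p2 \<and> q1 \<le> q2 then run_cone ss (p[k := p2 - p ! k], q[k := q2 - q ! k])
      else None)"

definition comb :: "int \<Rightarrow> int \<Rightarrow> int list \<Rightarrow> int list \<Rightarrow> int list" where
  "comb \<alpha> \<beta> p q = map2 (\<lambda>x y. \<alpha> * x + \<beta> * y) p q"

text \<open>Where the mutations are not linear on the whole cone spanned by \<open>p\<close> and \<open>q\<close>,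
  the cone is split at \<open>p + q\<close>, up to \<open>d\<close> times.\<close>

fun linear_on_cone :: "nat \<Rightarrow> (nat \<times> int list) list \<Rightarrow> int list \<times> int list \<Rightarrow> int list \<times> int list \<Rightarrow> bool" where
  "linear_on_cone 0 ss (p, q) (r, s) \<longleftrightarrow> run_cone ss (p, q) = Some (r, s)"
| "linear_on_cone (Suc d) ss (p, q) (r, s) \<longleftrightarrow>
    (case run_cone ss (p, q) of Some rs \<Rightarrow> rs = (r, s)
     | None \<Rightarrow> linear_on_cone d ss (p, comb 1 1 p q) (r, comb 1 1 r s) \<and>
               linear_on_cone d ss (comb 1 1 p q, q) (comb 1 1 r s, s))"

definition square_rows :: "int list list \<Rightarrow> bool" where
  "square_rows M \<longleftrightarrow> list_all (\<lambda>r. length r = length M) M"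

definition twist_certificate ::
  "nat \<Rightarrow> int list list \<Rightarrow> nat list \<Rightarrow> int list \<Rightarrow> int list \<Rightarrow> int \<Rightarrow> bool" where
  "twist_certificate d M w p q k \<longleftrightarrow> list_all (\<lambda>i. i < length M) w \<and> 0 < k \<and>
     foldl mutate_rows M w = M \<and>
     linear_on_cone d (exchange_columns M w) (p, q) (p, comb k 1 p q)"

definition ping_pong_certificate ::
  "nat \<Rightarrow> int list list \<Rightarrow> nat list \<Rightarrow> nat list \<Rightarrow> int list \<Rightarrow> int list \<Rightarrow> int \<Rightarrow> int \<Rightarrow> nat \<Rightarrow> nat \<Rightarrow> bool"
  where
  "ping_pong_certificate d M u v p q k l i j \<longleftrightarrow> square_rows M \<and>
     length p = length M \<and> length q = length M \<and> i < length M \<and> j < length M \<and>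
     p ! i * q ! j \<noteq> p ! j * q ! i \<and>
     twist_certificate d M u p q k \<and> twist_certificate d M v q p l"

lemma rows_mat_carrier [simp]: "rows_mat M \<in> carrier_mat (length M) (length M)"
  by (simp add: rows_mat_def)

lemma square_rowsD: "square_rows M \<Longrightarrow> i < length M \<Longrightarrow> length (M ! i) = length M"
  by (simp add: square_rows_def list_all_length)

lemma length_mutate_rows [simp]: "length (mutate_rows M k) = length M"
  by (simp add: mutate_rows_def)

lemma length_nth_mutate_rows:
  "square_rows M \<Longrightarrow> k < length M \<Longrightarrow> i < length M \<Longrightarrow> length (mutate_rows M k ! i) = length M"
  by (simp add: mutate_rows_def square_rowsD Let_def)

lemma square_rows_mutate_rows:
  "square_rows M \<Longrightarrow> k < length M \<Longrightarrow> square_rows (mutate_rows M k)"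
  by (simp add: length_nth_mutate_rows square_rows_def[of "mutate_rows M k"] list_all_length)

lemma nth_mutate_rows:
  assumes "square_rows M" "k < length M" "i < length M" "j < length M"
  shows "mutate_rows M k ! i ! j = (if k = i \<or> k = j then - (M ! i ! j)
     else M ! i ! j + mutation_term (M ! i ! k) (M ! k ! j))"
  using assms by (auto simp: mutate_rows_def square_rowsD Let_def nth_list_update mutation_term_def)

lemma rows_mat_mutate_rows:
  assumes "square_rows M" "k < length M"
  shows "rows_mat (mutate_rows M k) = mutate_mat (rows_mat M) k"
  by (rule eq_matI) (auto simp: rows_mat_def mutate_mat_eq nth_mutate_rows assms)

lemma pos_neg_part_eq_sum:
  assumes "length c = n" "length t = n"
  shows "pos_part c t = (\<Sum>i<n. max (c ! i) 0 * t ! i)"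
    "neg_part c t = (\<Sum>i<n. max (- c ! i) 0 * t ! i)"
  using assms by (simp_all add: pos_part_def neg_part_def sum_list_sum_nth atLeast0LessThan)

declare vec_of_list_index [simp]

lemma mutate_tropical_rows:
  assumes "square_rows M" "k < length M" "length t = length M"
  shows "mutate_tropical (vec_of_list t, rows_mat M) k =
    (vec_of_list (t[k := max (pos_part (map (\<lambda>r. r ! k) M) t) (neg_part (map (\<lambda>r. r ! k) M) t) - t ! k]),
     rows_mat (mutate_rows M k))"
proof -
  have "(\<Sum>i<length M. max (rows_mat M $$ (i, k)) 0 * vec_of_list t $ i)
      = pos_part (map (\<lambda>r. r ! k) M) t"
    "(\<Sum>i<length M. max (- rows_mat M $$ (i, k)) 0 * vec_of_list t $ i)
      = neg_part (map (\<lambda>r. r ! k) M) t"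
    using assms by (simp_all add: pos_neg_part_eq_sum[of _ "length M"] rows_mat_def)
  then show ?thesis
    unfolding mutate_tropical_def prod.case rows_mat_mutate_rows[OF assms(1,2)]
    using assms(2,3) by (auto intro!: eq_vecI simp: nth_list_update)
qed

lemma foldl_mutate_tropical_rows:
  assumes "square_rows M" "set w \<subseteq> {..<length M}" "length t = length M"
  shows "foldl mutate_tropical (vec_of_list t, rows_mat M) w =
    (vec_of_list (run_vector (exchange_columns M w) t), rows_mat (foldl mutate_rows M w))"
  using assms
  by (induction w arbitrary: M t) (auto simp: mutate_tropical_rows square_rows_mutate_rows)

section \<open>Linearity on cones\<close>

lemma length_comb [simp]: "length p = length q \<Longrightarrow> length (comb \<alpha> \<beta> p q) = length q"
  by (simp add: comb_def)

lemma pos_neg_part_comb: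
  assumes "length c = n" "length p = n" "length q = n"
  shows "pos_part c (comb \<alpha> \<beta> p q) = \<alpha> * pos_part c p + \<beta> * pos_part c q"
    "neg_part c (comb \<alpha> \<beta> p q) = \<alpha> * neg_part c p + \<beta> * neg_part c q"
  using assms
  by (simp_all add: pos_neg_part_eq_sum[of _ n] comb_def sum.distrib sum_distrib_left algebra_simps)

lemma comb_list_update:
  assumes "length p = length q" "k < length q"
  shows "(comb \<alpha> \<beta> p q)[k := \<alpha> * x + \<beta> * y - comb \<alpha> \<beta> p q ! k]
    = comb \<alpha> \<beta> (p[k := x - p ! k]) (q[k := y - q ! k])"
  using assms by (intro nth_equalityI) (auto simp: comb_def nth_list_update algebra_simps)

lemma run_cone_linear:
  assumes "run_cone ss (p, q) = Some (r, s)"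
    and "\<forall>(k, c) \<in> set ss. k < n \<and> length c = n" "length p = n" "length q = n"
    and "0 \<le> \<alpha>" "0 \<le> \<beta>"
  shows "run_vector ss (comb \<alpha> \<beta> p q) = comb \<alpha> \<beta> r s \<and> length r = n \<and> length s = n"
  using assms(1-4)
proof (induction ss arbitrary: p q)
  case (Cons a ss)
  obtain k c where a: "a = (k, c)" by fastforce
  have k: "k < n" "length c = n" using Cons.prems(2) a by auto
  note parts = pos_neg_part_comb[OF k(2) Cons.prems(3,4)]
  consider "neg_part c p \<le> pos_part c p" "neg_part c q \<le> pos_part c q"
      "run_cone ss (p[k := pos_part c p - p ! k], q[k := pos_part c q - q ! k]) = Some (r, s)"
    | "pos_part c p \<le> neg_part c p" "pos_part c q \<le> neg_part c q"
      "run_cone ss (p[k := neg_part c p - p ! k], q[k := neg_part c q - q ! k]) = Some (r, s)"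
    using Cons.prems(1) a by (auto simp: Let_def split: if_splits)
  then show ?case
  proof cases
    case 1
    then have "max (pos_part c (comb \<alpha> \<beta> p q)) (neg_part c (comb \<alpha> \<beta> p q))
        = \<alpha> * pos_part c p + \<beta> * pos_part c q"
      unfolding parts using assms(5,6) by (simp add: max_def add_mono mult_left_mono antisym)
    then show ?thesis
      using Cons.IH[OF 1(3)] Cons.prems k a by (simp add: comb_list_update)
  next
    case 2
    then have "max (pos_part c (comb \<alpha> \<beta> p q)) (neg_part c (comb \<alpha> \<beta> p q))
        = \<alpha> * neg_part c p + \<beta> * neg_part c q"
      unfolding parts using assms(5,6) by (simp add: max_def add_mono mult_left_mono antisym)
    then show ?thesis
      using Cons.IH[OF 2(3)] Cons.prems k a by (simp add: comb_list_update)
  qed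
qed simp

text \<open>The first form has nonnegative coefficients when \<open>\<beta> \<le> \<alpha>\<close>,
  the second when \<open>\<alpha> \<le> \<beta>\<close>: this places a point in one half of the cone
  split at \<open>p + q\<close>.\<close>

lemma comb_split:
  assumes "length p = length q"
  shows "comb \<alpha> \<beta> p q = comb (\<alpha> - \<beta>) \<beta> p (comb 1 1 p q)"
    "comb \<alpha> \<beta> p q = comb \<alpha> (\<beta> - \<alpha>) (comb 1 1 p q) q"
  using assms by (auto intro!: nth_equalityI simp: comb_def algebra_simps)

lemma linear_on_cone_run_vector:
  assumes "linear_on_cone d ss (p, q) (r, s)"
    and "\<forall>(k, c) \<in> set ss. k < n \<and> length c = n" "length p = n" "length q = n"
    and "length r = n" "length s = n" "0 \<le> \<alpha>" "0 \<le> \<beta>"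
  shows "run_vector ss (comb \<alpha> \<beta> p q) = comb \<alpha> \<beta> r s"
  using assms
proof (induction d arbitrary: p q r s \<alpha> \<beta>)
  case 0
  then show ?case using run_cone_linear by simp
next
  case (Suc d)
  show ?case
  proof (cases "run_cone ss (p, q)")
    case None
    then have lin: "linear_on_cone d ss (p, comb 1 1 p q) (r, comb 1 1 r s)"
      "linear_on_cone d ss (comb 1 1 p q, q) (comb 1 1 r s, s)"
      using Suc.prems(1) by auto
    show ?thesis
    proof (cases "\<beta> \<le> \<alpha>")
      case True
      then have "run_vector ss (comb (\<alpha> - \<beta>) \<beta> p (comb 1 1 p q)) = comb (\<alpha> - \<beta>) \<beta> r (comb 1 1 r s)"
        using Suc.prems by (intro Suc.IH[OF lin(1)]) auto
      then show ?thesis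
        using Suc.prems comb_split(1)[of p q \<alpha> \<beta>] comb_split(1)[of r s \<alpha> \<beta>] by simp
    next
      case False
      then have "run_vector ss (comb \<alpha> (\<beta> - \<alpha>) (comb 1 1 p q) q) = comb \<alpha> (\<beta> - \<alpha>) (comb 1 1 r s) s"
        using Suc.prems by (intro Suc.IH[OF lin(2)]) auto
      then show ?thesis
        using Suc.prems comb_split(2)[of p q \<alpha> \<beta>] comb_split(2)[of r s \<alpha> \<beta>] by simp
    qed
  next
    case (Some rs)
    then show ?thesis using Suc.prems run_cone_linear[of ss p q r s n \<alpha> \<beta>] by auto
  qed
qed

lemma exchange_columns_bounds:
  "set w \<subseteq> {..<length M} \<Longrightarrow> (k, c) \<in> set (exchange_columns M w) \<Longrightarrow>
    k < length M \<and> length c = length M"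
proof (induction w arbitrary: M)
  case (Cons a w)
  then show ?case using Cons.IH[of "mutate_rows M a"] by auto
qed simp

lemma vec_of_list_comb:
  assumes "length p = length q"
  shows "vec_of_list (comb \<alpha> \<beta> p q) = \<alpha> \<cdot>\<^sub>v vec_of_list p + \<beta> \<cdot>\<^sub>v vec_of_list q"
  using assms by (intro eq_vecI) (auto simp: comb_def)

lemma is_twist_certificate:
  assumes "twist_certificate d M w p q k" "square_rows M" "length p = length M" "length q = length M"
  shows "is_twist (rows_mat M) w (vec_of_list p) (vec_of_list q) k"
proof -
  have w: "set w \<subseteq> {..<length M}" and k: "0 < k" and M: "foldl mutate_rows M w = M"
    and lin: "linear_on_cone d (exchange_columns M w) (p, q) (p, comb k 1 p q)"
    using assms(1) by (auto simp: twist_certificate_def list_all_iff)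
  have "foldl mutate_tropical (\<alpha> \<cdot>\<^sub>v vec_of_list p + \<beta> \<cdot>\<^sub>v vec_of_list q, rows_mat M) w =
      ((\<alpha> + k * \<beta>) \<cdot>\<^sub>v vec_of_list p + \<beta> \<cdot>\<^sub>v vec_of_list q, rows_mat M)"
    if "0 \<le> \<alpha>" "0 \<le> \<beta>" for \<alpha> \<beta>
  proof -
    have "run_vector (exchange_columns M w) (comb \<alpha> \<beta> p q) = comb \<alpha> \<beta> p (comb k 1 p q)"
      using exchange_columns_bounds[OF w] assms(3,4) that
      by (intro linear_on_cone_run_vector[OF lin, of "length M"]) auto
    also have "\<dots> = comb (\<alpha> + k * \<beta>) \<beta> p q"
      using assms(3,4) by (intro nth_equalityI) (auto simp: comb_def algebra_simps)
    finally have "run_vector (exchange_columns M w) (comb \<alpha> \<beta> p q) = comb (\<alpha> + k * \<beta>) \<beta> p q" .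
    then show ?thesis
      using foldl_mutate_tropical_rows[OF assms(2) w, of "comb \<alpha> \<beta> p q"] assms(3,4) M
      by (simp add: vec_of_list_comb)
  qed
  then show ?thesis
    using w k by (simp add: is_twist_def rows_mat_def)
qed

lemma ping_pong_certificate:
  assumes "ping_pong_certificate d M u v p q k l i j"
  shows "ping_pong (rows_mat M)"
  unfolding ping_pong_def
proof (intro exI conjI)
  note c = assms[unfolded ping_pong_certificate_def]
  show "is_twist (rows_mat M) u (vec_of_list p) (vec_of_list q) k"
    using c by (blast intro: is_twist_certificate)
  show "is_twist (rows_mat M) v (vec_of_list q) (vec_of_list p) l"
    using c by (blast intro: is_twist_certificate)
  show "vec_of_list p \<in> carrier_vec (dim_row (rows_mat M))"
    "vec_of_list q \<in> carrier_vec (dim_row (rows_mat M))"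
    using c by (auto simp: rows_mat_def intro: carrier_vecI)
  show "i < dim_row (rows_mat M)" "j < dim_row (rows_mat M)"
    "vec_of_list p $ i * vec_of_list q $ j \<noteq> vec_of_list p $ j * vec_of_list q $ i"
    using c by (simp_all add: rows_mat_def)
qed

text \<open>The certificate may sit at a mutated matrix instead of the one with the given diagram;
  of the certificates below only that for \<open>E8_11\<close> has a nonempty
  \<open>ks\<close>.\<close>

definition mutates_to_ping_pong :: "int mat \<Rightarrow> bool" where
  "mutates_to_ping_pong B \<longleftrightarrow> (\<exists>ks. set ks \<subseteq> {..<dim_row B} \<and> ping_pong (foldl mutate_mat B ks))"

lemma foldl_mutate_rows:
  assumes "square_rows M" "set w \<subseteq> {..<length M}"
  shows "rows_mat (foldl mutate_rows M w) = foldl mutate_mat (rows_mat M) w"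
  using assms
  by (induction w arbitrary: M) (auto simp: rows_mat_mutate_rows square_rows_mutate_rows)

lemma mutates_to_ping_pongI:
  assumes "ping_pong_certificate d (foldl mutate_rows M ks) u v p q k l i j"
    and "square_rows M \<and> list_all (\<lambda>i. i < length M) ks"
  shows "mutates_to_ping_pong (rows_mat M)"
proof -
  have ks: "set ks \<subseteq> {..<length M}" using assms(2) by (auto simp: list_all_iff)
  have "ping_pong (foldl mutate_mat (rows_mat M) ks)"
    using ping_pong_certificate[OF assms(1)] foldl_mutate_rows[OF _ ks] assms(2) by simp
  with ks show ?thesis
    unfolding mutates_to_ping_pong_def by (intro exI[of _ ks]) (simp add: rows_mat_def)
qed

section \<open>Negation and permutation\<close>

lemma mutate_mat_uminus:
  assumes "B \<in> carrier_mat n n" "k < n"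
  shows "mutate_mat (- B) k = - mutate_mat B k"
  using assms by (intro eq_matI) (auto simp: mutate_mat_eq mutation_term_minus)

lemma foldl_mutate_mat_uminus:
  assumes "B \<in> carrier_mat n n" "set w \<subseteq> {..<n}"
  shows "foldl mutate_mat (- B) w = - foldl mutate_mat B w"
  using assms by (induction w arbitrary: B) (auto simp: mutate_mat_uminus[where n = n])

text \<open>Negating \<open>B\<close> swaps the two sums of the tropical exchange relation, and
  their maximum is symmetric. So the same words and rays serve the reversed diagram.\<close>

lemma mutate_tropical_uminus:
  assumes "B \<in> carrier_mat n n" "k < n" "dim_vec t = n"
  shows "mutate_tropical (t, - B) k = (fst (mutate_tropical (t, B) k), - mutate_mat B k)"
proof -
  have "(\<Sum>i<n. max ((- B) $$ (i, k)) 0 * t $ i) = (\<Sum>i<n. max (- B $$ (i, k)) 0 * t $ i)"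
    "(\<Sum>i<n. max (- (- B) $$ (i, k)) 0 * t $ i) = (\<Sum>i<n. max (B $$ (i, k)) 0 * t $ i)"
    using assms by (auto intro!: sum.cong)
  then show ?thesis
    unfolding mutate_tropical_def prod.case fst_conv mutate_mat_uminus[OF assms(1,2)] assms(3)
    by (simp only: max.commute)
qed

lemma foldl_mutate_tropical_uminus:
  assumes "B \<in> carrier_mat n n" "set w \<subseteq> {..<n}" "dim_vec t = n"
  shows "foldl mutate_tropical (t, - B) w =
    (fst (foldl mutate_tropical (t, B) w), - foldl mutate_mat B w)"
  using assms
proof (induction w arbitrary: t B)
  case (Cons k w)
  obtain t' where t': "mutate_tropical (t, B) k = (t', mutate_mat B k)"
    using mutate_tropical_snd[of "(t, B)" k] by (metis prod.collapse snd_conv)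
  then have "dim_vec t' = n" using mutate_tropical_dim[of "(t, B)" k] Cons.prems by simp
  with Cons t' show ?case by (simp add: mutate_tropical_uminus[where n = n])
qed simp

lemma is_twist_uminus:
  assumes "is_twist B w p q k" "B \<in> carrier_mat n n" "p \<in> carrier_vec n" "q \<in> carrier_vec n"
  shows "is_twist (- B) w p q k"
proof -
  have w: "set w \<subseteq> {..<n}" using assms(1,2) by (auto simp: is_twist_def)
  have "foldl mutate_tropical (\<alpha> \<cdot>\<^sub>v p + \<beta> \<cdot>\<^sub>v q, - B) w =
      ((\<alpha> + k * \<beta>) \<cdot>\<^sub>v p + \<beta> \<cdot>\<^sub>v q, - B)" if "0 \<le> \<alpha>" "0 \<le> \<beta>" for \<alpha> \<beta>
  proof -
    have e: "foldl mutate_tropical (\<alpha> \<cdot>\<^sub>v p + \<beta> \<cdot>\<^sub>v q, B) w = ((\<alpha> + k * \<beta>) \<cdot>\<^sub>v p + \<beta> \<cdot>\<^sub>v q, B)"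
      using assms(1) that by (simp add: is_twist_def)
    then have "foldl mutate_mat B w = B"
      using foldl_mutate_tropical_snd[of "(\<alpha> \<cdot>\<^sub>v p + \<beta> \<cdot>\<^sub>v q, B)" w] by simp
    then show ?thesis
      using foldl_mutate_tropical_uminus[OF assms(2) w, of "\<alpha> \<cdot>\<^sub>v p + \<beta> \<cdot>\<^sub>v q"] e assms(3,4) by simp
  qed
  then show ?thesis using assms(1) by (simp add: is_twist_def)
qed

lemma ping_pong_uminus:
  assumes "ping_pong B" "B \<in> carrier_mat n n"
  shows "ping_pong (- B)"
  using assms(1) assms(2) is_twist_uminus[of B _ _ _ _ n] unfolding ping_pong_def
  by (metis carrier_matD(1) index_uminus_mat(2))

lemma mutates_to_ping_pong_uminus:
  assumes "mutates_to_ping_pong B" "B \<in> carrier_mat n n"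
  shows "mutates_to_ping_pong (- B)"
proof -
  obtain ks where ks: "set ks \<subseteq> {..<n}" "ping_pong (foldl mutate_mat B ks)"
    using assms by (auto simp: mutates_to_ping_pong_def)
  then have "ping_pong (foldl mutate_mat (- B) ks)"
    using ping_pong_uminus[OF ks(2) foldl_mutate_mat_carrier[OF assms(2)]]
      foldl_mutate_mat_uminus[OF assms(2) ks(1)] by simp
  then show ?thesis using ks(1) assms(2) by (auto simp: mutates_to_ping_pong_def)
qed

section \<open>Renumbering the vertices\<close>

definition permute_vec :: "(nat \<Rightarrow> nat) \<Rightarrow> int vec \<Rightarrow> int vec" where
  "permute_vec \<pi> t = vec (dim_vec t) (\<lambda>i. t $ \<pi> i)"

lemma permute_vec_carrier [simp]: "t \<in> carrier_vec n \<Longrightarrow> permute_vec \<pi> t \<in> carrier_vec n"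
  by (auto simp: permute_vec_def)

lemma permute_mat_carrier [simp]: "B \<in> carrier_mat n n \<Longrightarrow> permute_mat \<pi> B \<in> carrier_mat n n"
  by (auto simp: permute_mat_def)

lemma permutes_lessThan: "\<pi> permutes {..<n} \<Longrightarrow> i < n \<Longrightarrow> \<pi> i < (n :: nat)"
  using permutes_in_image[of \<pi> "{..<n}" i] by simp

text \<open>Index \<open>k\<close> of the permuted matrix is index \<open>\<pi> k\<close> of
  \<open>B\<close>; words for \<open>B\<close> are therefore carried over by the inverse of
  \<open>\<pi>\<close>.\<close>

lemma mutate_mat_permute:
  assumes B: "B \<in> carrier_mat n n" and \<pi>: "\<pi> permutes {..<n}" and k: "k < n"
  shows "mutate_mat (permute_mat \<pi> B) k = permute_mat \<pi> (mutate_mat B (\<pi> k))"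
  using B k permutes_lessThan[OF \<pi>]
  by (intro eq_matI) (auto simp: permute_mat_def mutate_mat_eq inj_eq[OF permutes_inj[OF \<pi>]])

lemma foldl_mutate_mat_permute:
  assumes "B \<in> carrier_mat n n" "\<pi> permutes {..<n}" "set w \<subseteq> {..<n}"
  shows "foldl mutate_mat (permute_mat \<pi> B) w = permute_mat \<pi> (foldl mutate_mat B (map \<pi> w))"
  using assms by (induction w arbitrary: B) (auto simp: mutate_mat_permute[where n = n])

lemma mutate_tropical_permute:
  assumes B: "B \<in> carrier_mat n n" and \<pi>: "\<pi> permutes {..<n}" and k: "k < n"
    and t: "t \<in> carrier_vec n"
  shows "mutate_tropical (permute_vec \<pi> t, permute_mat \<pi> B) k =
    (permute_vec \<pi> (fst (mutate_tropical (t, B) (\<pi> k))), permute_mat \<pi> (mutate_mat B (\<pi> k)))"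
proof -
  have "(\<Sum>i<n. max (permute_mat \<pi> B $$ (i, k)) 0 * permute_vec \<pi> t $ i)
      = (\<Sum>i<n. max (B $$ (\<pi> i, \<pi> k)) 0 * t $ \<pi> i)"
    using assms by (auto intro!: sum.cong simp: permute_mat_def permute_vec_def)
  also have "\<dots> = (\<Sum>i<n. max (B $$ (i, \<pi> k)) 0 * t $ i)"
    by (rule sum.reindex_bij_betw[OF permutes_imp_bij[OF \<pi>]])
  finally have 1: "(\<Sum>i<n. max (permute_mat \<pi> B $$ (i, k)) 0 * permute_vec \<pi> t $ i) = \<dots>" .
  have "(\<Sum>i<n. max (- permute_mat \<pi> B $$ (i, k)) 0 * permute_vec \<pi> t $ i)
      = (\<Sum>i<n. max (- B $$ (\<pi> i, \<pi> k)) 0 * t $ \<pi> i)"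
    using assms by (auto intro!: sum.cong simp: permute_mat_def permute_vec_def)
  also have "\<dots> = (\<Sum>i<n. max (- B $$ (i, \<pi> k)) 0 * t $ i)"
    by (rule sum.reindex_bij_betw[OF permutes_imp_bij[OF \<pi>]])
  finally have 2: "(\<Sum>i<n. max (- permute_mat \<pi> B $$ (i, k)) 0 * permute_vec \<pi> t $ i) = \<dots>" .
  have d: "dim_vec (permute_vec \<pi> t) = n" "dim_vec t = n" using t by (auto simp: permute_vec_def)
  show ?thesis
    unfolding mutate_tropical_def prod.case fst_conv d 1 2 mutate_mat_permute[OF B \<pi> k]
    using k t permutes_lessThan[OF \<pi>]
    by (auto intro!: eq_vecI simp: permute_vec_def inj_eq[OF permutes_inj[OF \<pi>]])
qed

lemma foldl_mutate_tropical_permute: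
  assumes "B \<in> carrier_mat n n" "\<pi> permutes {..<n}" "set w \<subseteq> {..<n}" "t \<in> carrier_vec n"
  shows "foldl mutate_tropical (permute_vec \<pi> t, permute_mat \<pi> B) w =
    (permute_vec \<pi> (fst (foldl mutate_tropical (t, B) (map \<pi> w))),
     permute_mat \<pi> (foldl mutate_mat B (map \<pi> w)))"
  using assms
proof (induction w arbitrary: t B)
  case (Cons k w)
  obtain t' where t': "mutate_tropical (t, B) (\<pi> k) = (t', mutate_mat B (\<pi> k))"
    using mutate_tropical_snd[of "(t, B)" "\<pi> k"] by (metis prod.collapse snd_conv)
  then have "dim_vec t' = n"
    using mutate_tropical_dim[of "(t, B)" "\<pi> k"] carrier_vecD[OF Cons.prems(4)] by simp
  then have "t' \<in> carrier_vec n" by (rule carrier_vecI)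
  with Cons t' show ?case by (simp add: mutate_tropical_permute[where n = n])
qed simp

lemma permute_vec_linear:
  assumes "p \<in> carrier_vec n" "q \<in> carrier_vec n" "\<pi> permutes {..<n}"
  shows "permute_vec \<pi> (\<alpha> \<cdot>\<^sub>v p + \<beta> \<cdot>\<^sub>v q) = \<alpha> \<cdot>\<^sub>v permute_vec \<pi> p + \<beta> \<cdot>\<^sub>v permute_vec \<pi> q"
  using assms permutes_lessThan[OF assms(3)] by (intro eq_vecI) (auto simp: permute_vec_def)

lemma map_permutes_inv: "\<pi> permutes S \<Longrightarrow> map \<pi> (map (Hilbert_Choice.inv \<pi>) w) = w"
  by (simp add: map_idI permutes_inverses)

lemma set_map_inv:
  "\<pi> permutes {..<n} \<Longrightarrow> set w \<subseteq> {..<n} \<Longrightarrow> set (map (Hilbert_Choice.inv \<pi>) w) \<subseteq> {..<(n :: nat)}"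
  using permutes_lessThan[OF permutes_inv] by fastforce

lemma is_twist_permute:
  assumes tw: "is_twist B w p q k" and B: "B \<in> carrier_mat n n" and \<pi>: "\<pi> permutes {..<n}"
    and pq: "p \<in> carrier_vec n" "q \<in> carrier_vec n"
  shows "is_twist (permute_mat \<pi> B) (map (Hilbert_Choice.inv \<pi>) w) (permute_vec \<pi> p) (permute_vec \<pi> q) k"
proof -
  have w: "set w \<subseteq> {..<n}" using tw B by (auto simp: is_twist_def)
  note w' = set_map_inv[OF \<pi> w]
  have "foldl mutate_tropical (\<alpha> \<cdot>\<^sub>v permute_vec \<pi> p + \<beta> \<cdot>\<^sub>v permute_vec \<pi> q, permute_mat \<pi> B) (map (Hilbert_Choice.inv \<pi>) w) =
      ((\<alpha> + k * \<beta>) \<cdot>\<^sub>v permute_vec \<pi> p + \<beta> \<cdot>\<^sub>v permute_vec \<pi> q, permute_mat \<pi> B)"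
    if "0 \<le> \<alpha>" "0 \<le> \<beta>" for \<alpha> \<beta>
  proof -
    have e: "foldl mutate_tropical (\<alpha> \<cdot>\<^sub>v p + \<beta> \<cdot>\<^sub>v q, B) w = ((\<alpha> + k * \<beta>) \<cdot>\<^sub>v p + \<beta> \<cdot>\<^sub>v q, B)"
      using tw that by (simp add: is_twist_def)
    then have "foldl mutate_mat B w = B"
      using foldl_mutate_tropical_snd[of "(\<alpha> \<cdot>\<^sub>v p + \<beta> \<cdot>\<^sub>v q, B)" w] by simp
    then show ?thesis
      using foldl_mutate_tropical_permute[OF B \<pi> w', of "\<alpha> \<cdot>\<^sub>v p + \<beta> \<cdot>\<^sub>v q"] e pq
      unfolding map_permutes_inv[OF \<pi>] by (simp add: permute_vec_linear[OF pq \<pi>])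
  qed
  moreover have "dim_row (permute_mat \<pi> B) = n" using B by (simp add: permute_mat_def)
  ultimately show ?thesis using tw w' by (simp add: is_twist_def)
qed

lemma ping_pong_permute:
  assumes pp: "ping_pong B" and B: "B \<in> carrier_mat n n" and \<pi>: "\<pi> permutes {..<n}"
  shows "ping_pong (permute_mat \<pi> B)"
proof -
  obtain u v p q k l i j where tw: "is_twist B u p q k" "is_twist B v q p l"
    and pq: "p \<in> carrier_vec n" "q \<in> carrier_vec n"
    and ij: "i < n" "j < n" "p $ i * q $ j \<noteq> p $ j * q $ i"
    using pp B unfolding ping_pong_def by auto
  have d: "dim_row (permute_mat \<pi> B) = n" using B by (simp add: permute_mat_def)
  have inv: "Hilbert_Choice.inv \<pi> i < n" "Hilbert_Choice.inv \<pi> j < n"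
    using permutes_lessThan[OF permutes_inv[OF \<pi>]] ij by auto
  have "permute_vec \<pi> x $ Hilbert_Choice.inv \<pi> r = x $ r" if "x \<in> carrier_vec n" "r < n" for x r
    using that permutes_lessThan[OF permutes_inv[OF \<pi>]]
    by (simp add: permute_vec_def permutes_inverses[OF \<pi>])
  then have "permute_vec \<pi> p $ Hilbert_Choice.inv \<pi> i * permute_vec \<pi> q $ Hilbert_Choice.inv \<pi> j \<noteq>
      permute_vec \<pi> p $ Hilbert_Choice.inv \<pi> j * permute_vec \<pi> q $ Hilbert_Choice.inv \<pi> i"
    using pq ij by simp
  then show ?thesis
    unfolding ping_pong_def d
    using is_twist_permute[OF tw(1) B \<pi> pq] is_twist_permute[OF tw(2) B \<pi> pq(2,1)] inv pq
    by (meson permute_vec_carrier)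
qed

lemma mutates_to_ping_pong_permute:
  assumes "mutates_to_ping_pong B" "B \<in> carrier_mat n n" "\<pi> permutes {..<n}"
  shows "mutates_to_ping_pong (permute_mat \<pi> B)"
proof -
  obtain ks where ks: "set ks \<subseteq> {..<n}" "ping_pong (foldl mutate_mat B ks)"
    using assms by (auto simp: mutates_to_ping_pong_def)
  note ks' = set_map_inv[OF assms(3) ks(1)]
  have "ping_pong (foldl mutate_mat (permute_mat \<pi> B) (map (Hilbert_Choice.inv \<pi>) ks))"
    unfolding foldl_mutate_mat_permute[OF assms(2,3) ks'] map_permutes_inv[OF assms(3)]
    by (rule ping_pong_permute[OF ks(2) foldl_mutate_mat_carrier[OF assms(2)] assms(3)])
  moreover have "dim_row (permute_mat \<pi> B) = n" using assms(2) by (simp add: permute_mat_def)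
  ultimately show ?thesis using ks' unfolding mutates_to_ping_pong_def by blast
qed

section \<open>Matrices with a given diagram\<close>

lemma permute_mat_inv:
  assumes "B \<in> carrier_mat n n" "\<pi> permutes {..<n}"
  shows "permute_mat (Hilbert_Choice.inv \<pi>) (permute_mat \<pi> B) = B"
  using assms permutes_lessThan[OF permutes_inv[OF assms(2)]]
  by (intro eq_matI) (auto simp: permute_mat_def permutes_inverses[OF assms(2)])

lemma skew_weights_permute:
  assumes "skew_weights d B" "B \<in> carrier_mat n n" "\<pi> permutes {..<n}"
  shows "skew_weights (d \<circ> \<pi>) (permute_mat \<pi> B)"
proof -
  have d: "dim_row (permute_mat \<pi> B) = n" "dim_row B = n"
    using assms(2) by (auto simp: permute_mat_def)
  have e: "permute_mat \<pi> B $$ (i, j) = B $$ (\<pi> i, \<pi> j)" if "i < n" "j < n" for i j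
    using assms(2) that by (simp add: permute_mat_def)
  show ?thesis
    using assms(1) permutes_lessThan[OF assms(3)] e unfolding skew_weights_def d o_def by metis
qed

lemma skew_weights_uminus:
  assumes "skew_weights d B" "B \<in> carrier_mat n n"
  shows "skew_weights d (- B)"
proof -
  have d: "dim_row (- B) = n" "dim_row B = n" using assms(2) by auto
  have e: "(- B) $$ (i, j) = - B $$ (i, j)" if "i < n" "j < n" for i j
    using assms(2) that by simp
  show ?thesis
    using assms(1) e unfolding skew_weights_def d by (metis mult_minus_left)
qed

text \<open>Opposite entries of \<open>N\<close> have opposite signs, so an entry becomes positive
  exactly when its mirror entry was. Weights survive because both factors change sign.\<close>

lemma diagram_of_uminus:
  assumes N: "N \<in> carrier_mat n n" and d: "skew_weights d N"
  shows "diagram_of (- N) = reverse_diagram (diagram_of N)"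
proof -
  have n: "dim_row N = n" "dim_row (- N) = n" using N by auto
  have sg: "0 < (- N) $$ (i, j) \<longleftrightarrow> 0 < N $$ (j, i)" if "i < n" "j < n" for i j
    using skew_weights_sign[OF d, of j i] that N by auto
  have e: "- ((- N) $$ (i, j) * (- N) $$ (j, i)) = - (N $$ (j, i) * N $$ (i, j))"
    if "i < n" "j < n" for i j
    using that N by simp
  have "{(i, j, - ((- N) $$ (i, j) * (- N) $$ (j, i))) | i j. i < n \<and> j < n \<and> 0 < (- N) $$ (i, j)}
      = {(i, j, - (N $$ (j, i) * N $$ (i, j))) | i j. i < n \<and> j < n \<and> 0 < N $$ (j, i)}"
    using sg e by (metis (no_types, lifting))
  also have "\<dots> = (\<lambda>(i, j, w). (j, i, w)) `
      {(i, j, - (N $$ (i, j) * N $$ (j, i))) | i j. i < n \<and> j < n \<and> 0 < N $$ (i, j)}"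
    by (auto simp: image_iff)
  finally show ?thesis by (simp add: diagram_of_def reverse_diagram_def n)
qed

lemma reverse_reverse_diagram [simp]: "reverse_diagram (reverse_diagram S) = S"
proof -
  have "(\<lambda>(i, j, w). (j, i, w)) ` (\<lambda>(i, j, w). (j, i, w)) ` A = A" for A :: "(nat \<times> nat \<times> int) set"
    by (simp add: image_image case_prod_unfold)
  then show ?thesis by (simp add: reverse_diagram_def)
qed

lemma diagram_arrow:
  assumes "diagram_of N = (n, A)" "(i, j, w) \<in> A"
  shows "i < n" "j < n" "0 < N $$ (i, j)" "w = - (N $$ (i, j) * N $$ (j, i))"
  using assms by (auto simp: diagram_of_def)

lemma diagram_no_arrow:
  assumes "diagram_of N = (n, A)" "skew_weights d N" "i < n" "j < n"
    and "\<And>w. (i, j, w) \<notin> A" "\<And>w. (j, i, w) \<notin> A"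
  shows "N $$ (i, j) = 0"
proof -
  have n: "dim_row N = n" and A: "A = {(i, j, - (N $$ (i, j) * N $$ (j, i))) | i j.
      i < n \<and> j < n \<and> 0 < N $$ (i, j)}"
    using assms(1) by (auto simp: diagram_of_def)
  have "\<not> 0 < N $$ (i, j)" "\<not> 0 < N $$ (j, i)"
    using assms(3-6) unfolding A by blast+
  then show ?thesis
    using skew_weights_sign[OF assms(2), of j i] assms(3,4) n by auto
qed

definition rows_supported :: "int list list \<Rightarrow> (nat \<times> nat \<times> int) list \<Rightarrow> bool" where
  "rows_supported M A \<longleftrightarrow> square_rows M \<and>
     list_all (\<lambda>i. list_all (\<lambda>j. M ! i ! j = 0 \<or>
       list_ex (\<lambda>(a, b, w). a = i \<and> b = j \<or> a = j \<and> b = i) A) [0..<length M]) [0..<length M]"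

text \<open>Off the arrows both matrices vanish, \<open>N\<close> by its sign pattern and
  \<open>M\<close> by \<open>rows_supported\<close>, so only the entries on arrows have to be
  known.\<close>

lemma eq_rows_matI:
  assumes N: "N \<in> carrier_mat n n" "skew_weights d N" "diagram_of N = (n, set A)"
    and M: "rows_supported M A" "length M = n"
    and entries: "\<And>i j w. (i, j, w) \<in> set A \<Longrightarrow> N $$ (i, j) = M ! i ! j \<and> N $$ (j, i) = M ! j ! i"
  shows "N = rows_mat M"
proof (rule eq_matI)
  fix i j assume "i < dim_row (rows_mat M)" "j < dim_col (rows_mat M)"
  then have ij: "i < n" "j < n" using M(2) by (auto simp: rows_mat_def)
  have "N $$ (i, j) = M ! i ! j"
  proof (cases "\<exists>w. (i, j, w) \<in> set A \<or> (j, i, w) \<in> set A")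
    case True
    then show ?thesis using entries by blast
  next
    case False
    then have "N $$ (i, j) = 0" using diagram_no_arrow[OF N(3,2) ij] by blast
    moreover have "M ! i ! j = 0 \<or> (\<exists>(a, b, w) \<in> set A. a = i \<and> b = j \<or> a = j \<and> b = i)"
      using M ij by (auto simp: rows_supported_def list_all_iff list_ex_iff)
    with False have "M ! i ! j = 0" by auto
    ultimately show ?thesis by simp
  qed
  then show "N $$ (i, j) = rows_mat M $$ (i, j)" using ij M(2) by (simp add: rows_mat_def)
qed (use N M in \<open>auto simp: rows_mat_def\<close>)

lemma diagram_arrow_skew_weights:
  assumes "diagram_of N = (n, A)" "skew_weights d N" "(i, j, w) \<in> A"
  shows "0 < d i" "0 < d j" "0 < - N $$ (j, i)" "N $$ (i, j) * (- N $$ (j, i)) = w"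
    "N $$ (i, j) * d j = (- N $$ (j, i)) * d i"
proof -
  note a = diagram_arrow[OF assms(1,3)]
  have n: "dim_row N = n" using assms(1) by (simp add: diagram_of_def)
  show "0 < d i" "0 < d j"
    using assms(2) a(1,2) unfolding skew_weights_def n by blast+
  have "N $$ (i, j) * d j = - (N $$ (j, i) * d i)"
    using assms(2) a(1,2) unfolding skew_weights_def n by blast
  then show "N $$ (i, j) * d j = (- N $$ (j, i)) * d i" by simp
  show "0 < - N $$ (j, i)" using skew_weights_sign[OF assms(2), of i j] a n by simp
  show "N $$ (i, j) * (- N $$ (j, i)) = w" using a(4) by simp
qed

lemma small_factorizations:
  fixes x y :: int
  assumes "0 < x" "0 < y"
  shows "x * y = 1 \<Longrightarrow> x = 1 \<and> y = 1"
    and "x * y = 2 \<Longrightarrow> x = 1 \<and> y = 2 \<or> x = 2 \<and> y = 1"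
    and "x * y = 3 \<Longrightarrow> x = 1 \<and> y = 3 \<or> x = 3 \<and> y = 1"
    and "x * y = 4 \<Longrightarrow> x = 1 \<and> y = 4 \<or> x = 2 \<and> y = 2 \<or> x = 4 \<and> y = 1"
proof -
  have le: "x \<le> x * y" using assms by simp
  show "x * y = 1 \<Longrightarrow> x = 1 \<and> y = 1" using assms by (simp add: pos_zmult_eq_1_iff)
  show "x = 1 \<and> y = 2 \<or> x = 2 \<and> y = 1" if "x * y = 2"
  proof -
    have "x = 1 \<or> x = 2" using le assms that by linarith
    then show ?thesis using that by auto
  qed
  show "x = 1 \<and> y = 3 \<or> x = 3 \<and> y = 1" if "x * y = 3"
  proof -
    have "x = 1 \<or> x = 2 \<or> x = 3" using le assms that by linarith
    then show ?thesis using that by (elim disjE; simp; presburger)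
  qed
  show "x = 1 \<and> y = 4 \<or> x = 2 \<and> y = 2 \<or> x = 4 \<and> y = 1" if "x * y = 4"
  proof -
    have "x = 1 \<or> x = 2 \<or> x = 3 \<or> x = 4" using le assms that by linarith
    then show ?thesis using that by (elim disjE; simp; presburger)
  qed
qed

text \<open>A weight fixes only the product of two opposite entries. Recording the ratio of the
  symmetrizing weights with each factorization lets cycles of the diagram rule out inconsistent
  choices.\<close>

lemma arrow_entries:
  assumes N: "diagram_of N = (n, A)" "skew_weights d N"
  shows "(i, j, 1) \<in> A \<Longrightarrow> N $$ (i, j) = 1 \<and> N $$ (j, i) = -1 \<and> d i = d j"
    and "(i, j, 2) \<in> A \<Longrightarrow> N $$ (i, j) = 1 \<and> N $$ (j, i) = -2 \<and> d j = 2 * d i \<or>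
      N $$ (i, j) = 2 \<and> N $$ (j, i) = -1 \<and> d i = 2 * d j"
    and "(i, j, 3) \<in> A \<Longrightarrow> N $$ (i, j) = 1 \<and> N $$ (j, i) = -3 \<and> d j = 3 * d i \<or>
      N $$ (i, j) = 3 \<and> N $$ (j, i) = -1 \<and> d i = 3 * d j"
    and "(i, j, 4) \<in> A \<Longrightarrow> N $$ (i, j) = 1 \<and> N $$ (j, i) = -4 \<and> d j = 4 * d i \<or>
      N $$ (i, j) = 2 \<and> N $$ (j, i) = -2 \<and> d i = d j \<or>
      N $$ (i, j) = 4 \<and> N $$ (j, i) = -1 \<and> d i = 4 * d j"
proof -
  have *: thesis if "(i, j, w) \<in> A"
    "\<And>x y. 0 < x \<Longrightarrow> 0 < y \<Longrightarrow> x * y = w \<Longrightarrow> N $$ (i, j) = x \<Longrightarrow> N $$ (j, i) = - y \<Longrightarrow>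
      x * d j = y * d i \<Longrightarrow> thesis" for w thesis
    using that(2)[of "N $$ (i, j)" "- N $$ (j, i)"] diagram_arrow(3)[OF N(1) that(1)]
      diagram_arrow_skew_weights[OF N that(1)] by simp
  show "N $$ (i, j) = 1 \<and> N $$ (j, i) = -1 \<and> d i = d j" if "(i, j, 1) \<in> A"
    by (rule *[OF that], drule (2) small_factorizations(1)) auto
  show "N $$ (i, j) = 1 \<and> N $$ (j, i) = -2 \<and> d j = 2 * d i \<or>
      N $$ (i, j) = 2 \<and> N $$ (j, i) = -1 \<and> d i = 2 * d j" if "(i, j, 2) \<in> A"
    by (rule *[OF that], drule (2) small_factorizations(2)) auto
  show "N $$ (i, j) = 1 \<and> N $$ (j, i) = -3 \<and> d j = 3 * d i \<or>
      N $$ (i, j) = 3 \<and> N $$ (j, i) = -1 \<and> d i = 3 * d j" if "(i, j, 3) \<in> A"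
    by (rule *[OF that], drule (2) small_factorizations(3)) auto
  show "N $$ (i, j) = 1 \<and> N $$ (j, i) = -4 \<and> d j = 4 * d i \<or>
      N $$ (i, j) = 2 \<and> N $$ (j, i) = -2 \<and> d i = d j \<or>
      N $$ (i, j) = 4 \<and> N $$ (j, i) = -1 \<and> d i = 4 * d j" if "(i, j, 4) \<in> A"
    by (rule *[OF that], drule (2) small_factorizations(4)) auto
qed

text \<open>In the diagrams without arrows of weight 2 or 3, every arrow of weight 4 closes up a
  triangle with two arrows of weight 1, so all the symmetrizing weights agree.\<close>

definition simply_laced_rows :: "int list list \<Rightarrow> (nat \<times> nat \<times> int) list \<Rightarrow> bool" where
  "simply_laced_rows M A \<longleftrightarrow> list_all (\<lambda>(i, j, w).
     w = 1 \<and> M ! i ! j = 1 \<and> M ! j ! i = -1 \<or>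
     w = 4 \<and> M ! i ! j = 2 \<and> M ! j ! i = -2 \<and>
       list_ex (\<lambda>(a, b, w'). a = j \<and> w' = 1 \<and> List.member A (b, i, 1)) A) A"

lemma eq_simply_laced_rows:
  assumes N: "N \<in> carrier_mat n n" "skew_weights d N" "diagram_of N = (n, set A)"
    and M: "rows_supported M A \<and> simply_laced_rows M A \<and> length M = n"
  shows "N = rows_mat M"
proof (rule eq_rows_matI[OF N])
  note entries = arrow_entries[OF N(3,2)]
  fix i j w assume ijw: "(i, j, w) \<in> set A"
  then consider "w = 1" "M ! i ! j = 1" "M ! j ! i = -1"
    | b where "w = 4" "M ! i ! j = 2" "M ! j ! i = -2" "(j, b, 1) \<in> set A" "(b, i, 1) \<in> set A"
    using M unfolding simply_laced_rows_def list_all_iff list_ex_iff List.member_iff by fastforce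
  then show "N $$ (i, j) = M ! i ! j \<and> N $$ (j, i) = M ! j ! i"
  proof cases
    case 1
    then show ?thesis using entries(1) ijw by simp
  next
    case 2
    then have "d i = d j" using entries(1)[of j b] entries(1)[of b i] by simp
    \<comment> \<open>Positivity excludes \<open>d j = 4 * d i\<close> and
      \<open>d i = 4 * d j\<close>, leaving the factorization 2 times 2.\<close>
    moreover have "0 < d j" using diagram_arrow_skew_weights(2)[OF N(3,2) ijw] .
    ultimately show ?thesis using entries(4)[of i j] ijw 2 by auto
  qed
qed (use M in auto)

definition arm_arrows :: "nat \<Rightarrow> nat \<Rightarrow> (nat \<times> nat \<times> int) list" where
  "arm_arrows s l = (1, s, 1) # (s, 0, 1) # map (\<lambda>j. (s + j, s + j + 1, 1)) [0..<l - 1]"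

lemma arm_eq: "arm s l = set (arm_arrows s l)"
  by (auto simp: arm_def arm_arrows_def)

lemma three_arms_eq:
  "three_arms l1 l2 l3 = (2 + l1 + l2 + l3,
     set ((0, 1, 4) # arm_arrows 2 l1 @ arm_arrows (2 + l1) l2 @ arm_arrows (2 + l1 + l2) l3))"
  by (simp add: three_arms_def arm_eq Un_assoc)

section \<open>Certificates for the nine types\<close>

text \<open>In each case both sequences are conjugates of a mutation sequence \<open>i, j\<close> at the ends of
  an arrow of weight 4, which acts like a Dehn twist, and \<open>p\<close> and \<open>q\<close> span the rays fixed by
  the two twists. A diagram with arrows of weight 2 or 3 has two symmetrizable
  matrices; the primed one is minus the transpose of the other. The data were found by computer search.\<close>

definition X6_rows :: "int list list" where
  "X6_rows =
    [[0, 1, -1, 1, -1, 1], [-1, 0, 2, 0, 0, 0], [1, -2, 0, 0, 0, 0], [-1, 0, 0, 0, 2, 0],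
     [1, 0, 0, -2, 0, 0], [-1, 0, 0, 0, 0, 0]]"

lemma X6_rows_mutates_to_ping_pong: "mutates_to_ping_pong (rows_mat X6_rows)"
  by (rule mutates_to_ping_pongI[where d = 0 and i = 0 and j = 1 and k = 2 and l = 2
      and ks = "[]"
      and u = "[1, 2]"
      and v = "[0, 3, 4, 5, 2, 4, 3, 0]"
      and p = "[0, 1, 1, 0, 0, 0]"
      and q = "[2, 0, 1, 1, 1, 1]"])
    code_simp+

definition X7_rows :: "int list list" where
  "X7_rows =
    [[0, 1, -1, 1, -1, 1, -1], [-1, 0, 2, 0, 0, 0, 0], [1, -2, 0, 0, 0, 0, 0],
     [-1, 0, 0, 0, 2, 0, 0], [1, 0, 0, -2, 0, 0, 0], [-1, 0, 0, 0, 0, 0, 2],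
     [1, 0, 0, 0, 0, -2, 0]]"

lemma X7_rows_mutates_to_ping_pong: "mutates_to_ping_pong (rows_mat X7_rows)"
  by (rule mutates_to_ping_pongI[where d = 0 and i = 0 and j = 3 and k = 2 and l = 2
      and ks = "[]"
      and u = "[3, 4]"
      and v = "[0, 1, 2, 5, 4, 2, 1, 0]"
      and p = "[0, 0, 0, 1, 1, 0, 0]"
      and q = "[2, 1, 1, 0, 1, 1, 0]"])
    code_simp+

definition E6_11_rows :: "int list list" where
  "E6_11_rows =
    [[0, 2, -1, 0, -1, 0, -1, 0], [-2, 0, 1, 0, 1, 0, 1, 0], [1, -1, 0, 1, 0, 0, 0, 0],
     [0, 0, -1, 0, 0, 0, 0, 0], [1, -1, 0, 0, 0, 1, 0, 0], [0, 0, 0, 0, -1, 0, 0, 0],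
     [1, -1, 0, 0, 0, 0, 0, 1], [0, 0, 0, 0, 0, 0, -1, 0]]"

text \<open>\<open>p\<close> has the coefficients of the null root of the affine E6 diagram on the
  vertices 1 to 7, and \<open>u\<close> mutates only at these vertices.\<close>

lemma E6_11_rows_mutates_to_ping_pong: "mutates_to_ping_pong (rows_mat E6_11_rows)"
  by (rule mutates_to_ping_pongI[where d = 0 and i = 0 and j = 1 and k = 6 and l = 6
      and ks = "[]"
      and u = "[2, 3, 1, 4, 6, 3, 1, 5, 7, 2, 3, 7, 5, 1, 3, 6, 4, 1, 3, 2]"
      and v = "[2, 4, 6, 1, 0, 3, 5, 7, 1, 2, 4, 6, 0, 1, 6, 4, 2, 1, 7, 5, 3, 0, 1, 6, 4, 2]"
      and p = "[0, 3, 2, 1, 2, 1, 2, 1]"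
      and q = "[1, 5, 4, 2, 4, 2, 4, 2]"])
    code_simp+

definition E7_11_rows :: "int list list" where
  "E7_11_rows =
    [[0, 2, -1, -1, 0, 0, -1, 0, 0], [-2, 0, 1, 1, 0, 0, 1, 0, 0], [1, -1, 0, 0, 0, 0, 0, 0, 0],
     [1, -1, 0, 0, 1, 0, 0, 0, 0], [0, 0, 0, -1, 0, 1, 0, 0, 0], [0, 0, 0, 0, -1, 0, 0, 0, 0],
     [1, -1, 0, 0, 0, 0, 0, 1, 0], [0, 0, 0, 0, 0, 0, -1, 0, 1], [0, 0, 0, 0, 0, 0, 0, -1, 0]]"

text \<open>\<open>p\<close> and \<open>u\<close> live on the weight-4 arrow, \<open>q\<close> and
  \<open>v\<close> on the affine E7 diagram left when vertex 0 is deleted. On its subdiagram each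
  vector t solves 2 t_k = sum over i of |b_ik| t_i, so \<open>q\<close> has the coefficients of the
  null root. The rays for \<open>G2_star_plus\<close> and \<open>F4_star_plus\<close> arise in the
  same way.\<close>

lemma E7_11_rows_mutates_to_ping_pong: "mutates_to_ping_pong (rows_mat E7_11_rows)"
  by (rule mutates_to_ping_pongI[where d = 2 and i = 0 and j = 1 and k = 8 and l = 8
      and ks = "[]"
      and u = "[0, 1]"
      and v = "[2, 3, 1, 4, 6, 7, 2, 1, 3, 5, 8, 2, 7, 8, 5, 3, 1, 2, 7, 6, 4, 1, 3, 2]"
      and p = "[1, 1, 0, 0, 0, 0, 0, 0, 0]"
      and q = "[0, 4, 2, 3, 2, 1, 3, 2, 1]"])
    code_simp+

definition E8_11_rows :: "int list list" where
  "E8_11_rows =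
    [[0, 2, -1, -1, 0, -1, 0, 0, 0, 0], [-2, 0, 1, 1, 0, 1, 0, 0, 0, 0],
     [1, -1, 0, 0, 0, 0, 0, 0, 0, 0], [1, -1, 0, 0, 1, 0, 0, 0, 0, 0],
     [0, 0, 0, -1, 0, 0, 0, 0, 0, 0], [1, -1, 0, 0, 0, 0, 1, 0, 0, 0],
     [0, 0, 0, 0, 0, -1, 0, 1, 0, 0], [0, 0, 0, 0, 0, 0, -1, 0, 1, 0],
     [0, 0, 0, 0, 0, 0, 0, -1, 0, 1], [0, 0, 0, 0, 0, 0, 0, 0, -1, 0]]"

text \<open>\<open>v\<close> is \<open>rev u\<close>, then the word from \<open>[1, 3, 5]\<close> to
  \<open>[5, 3, 1]\<close>, then \<open>u\<close>: it is conjugated by the first twist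
  itself.\<close>

lemma E8_11_rows_mutates_to_ping_pong: "mutates_to_ping_pong (rows_mat E8_11_rows)"
  by (rule mutates_to_ping_pongI[where d = 2 and i = 0 and j = 1 and k = 12 and l = 12
      and ks = "[8, 7, 1, 3, 9, 6, 0, 7, 4, 2, 4, 8, 5, 9, 7, 1, 6, 9, 7, 3, 9, 1, 5, 0, 7, 2, 9, 5,
          9, 6, 2, 9, 5, 8, 9, 1]"
      and u = "[2, 7, 4, 0, 6, 8, 1, 4, 8, 6, 0, 4, 7, 2]"
      and v = "[2, 7, 4, 0, 6, 8, 4, 1, 8, 6, 0, 4, 7, 2, 1, 3, 5, 4, 0, 8, 9, 3, 4, 9, 8, 0, 4, 5,
          3, 1, 2, 7, 4, 0, 6, 8, 1, 4, 8, 6, 0, 4, 7, 2]"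
      and p = "[1, 1, 1, 0, 2, 0, 1, 2, 1, 0]"
      and q = "[13, 10, 12, 1, 22, 2, 12, 24, 13, 1]"])
    code_simp+

definition G2_star_plus_rows :: "int list list" where
  "G2_star_plus_rows =
    [[0, 2, -1, 0], [-2, 0, 1, 0], [3, -3, 0, 1], [0, 0, -1, 0]]"

lemma G2_star_plus_rows_mutates_to_ping_pong: "mutates_to_ping_pong (rows_mat G2_star_plus_rows)"
  by (rule mutates_to_ping_pongI[where d = 0 and i = 0 and j = 1 and k = 6 and l = 2
      and ks = "[]"
      and u = "[0, 1]"
      and v = "[2, 1, 3, 2, 1, 2]"
      and p = "[1, 1, 0, 0]"
      and q = "[0, 3, 2, 1]"])
    code_simp+

definition G2_star_plus_rows' :: "int list list" where
  "G2_star_plus_rows' =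
    [[0, 2, -3, 0], [-2, 0, 3, 0], [1, -1, 0, 1], [0, 0, -1, 0]]"

text \<open>The words are those of the unprimed matrix: passing to minus the transpose multiplies
  entry (i, k) by d k / d i, so scaling each coordinate i by d i carries one tropical mutation to
  the other. With weights 1, 1, 3, 3 the old \<open>q\<close> becomes 3 times the new one, which
  turns the multipliers 6, 2 into 2, 6. The other primed certificates arise in the same way.\<close>

lemma G2_star_plus_rows'_mutates_to_ping_pong: "mutates_to_ping_pong (rows_mat G2_star_plus_rows')"
  by (rule mutates_to_ping_pongI[where d = 0 and i = 0 and j = 1 and k = 2 and l = 6
      and ks = "[]"
      and u = "[0, 1]"
      and v = "[2, 1, 3, 2, 1, 2]"
      and p = "[1, 1, 0, 0]"
      and q = "[0, 1, 2, 1]"])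
    code_simp+

definition G2_star_star_rows :: "int list list" where
  "G2_star_star_rows =
    [[0, 2, -1, -1], [-2, 0, 1, 1], [1, -1, 0, 0], [3, -3, 0, 0]]"

lemma G2_star_star_rows_mutates_to_ping_pong: "mutates_to_ping_pong (rows_mat G2_star_star_rows)"
  by (rule mutates_to_ping_pongI[where d = 0 and i = 0 and j = 1 and k = 4 and l = 4
      and ks = "[]"
      and u = "[2, 3, 1, 0, 3, 2]"
      and v = "[2, 0, 3, 2, 0, 3, 0, 2]"
      and p = "[1, 1, 1, 1]"
      and q = "[2, 0, 1, 1]"])
    code_simp+

definition G2_star_star_rows' :: "int list list" where
  "G2_star_star_rows' =
    [[0, 2, -1, -3], [-2, 0, 1, 3], [1, -1, 0, 0], [1, -1, 0, 0]]"

lemma G2_star_star_rows'_mutates_to_ping_pong: "mutates_to_ping_pong (rows_mat G2_star_star_rows')"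
  by (rule mutates_to_ping_pongI[where d = 0 and i = 0 and j = 1 and k = 4 and l = 4
      and ks = "[]"
      and u = "[2, 3, 1, 0, 3, 2]"
      and v = "[2, 0, 3, 2, 0, 3, 0, 2]"
      and p = "[1, 1, 1, 3]"
      and q = "[2, 0, 1, 3]"])
    code_simp+

definition F4_star_plus_rows :: "int list list" where
  "F4_star_plus_rows =
    [[0, 2, -1, -1, 0, 0], [-2, 0, 1, 1, 0, 0], [1, -1, 0, 0, 0, 0], [2, -2, 0, 0, 1, 0],
     [0, 0, 0, -1, 0, 1], [0, 0, 0, 0, -1, 0]]"

lemma F4_star_plus_rows_mutates_to_ping_pong: "mutates_to_ping_pong (rows_mat F4_star_plus_rows)"
  by (rule mutates_to_ping_pongI[where d = 0 and i = 0 and j = 1 and k = 8 and l = 4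
      and ks = "[]"
      and u = "[0, 1]"
      and v = "[2, 3, 1, 4, 2, 3, 5, 4, 3, 2, 4, 1, 3, 2]"
      and p = "[1, 1, 0, 0, 0, 0]"
      and q = "[0, 4, 2, 3, 2, 1]"])
    code_simp+

definition F4_star_plus_rows' :: "int list list" where
  "F4_star_plus_rows' =
    [[0, 2, -1, -2, 0, 0], [-2, 0, 1, 2, 0, 0], [1, -1, 0, 0, 0, 0], [1, -1, 0, 0, 1, 0],
     [0, 0, 0, -1, 0, 1], [0, 0, 0, 0, -1, 0]]"

lemma F4_star_plus_rows'_mutates_to_ping_pong: "mutates_to_ping_pong (rows_mat F4_star_plus_rows')"
  by (rule mutates_to_ping_pongI[where d = 0 and i = 0 and j = 1 and k = 4 and l = 8
      and ks = "[]"
      and u = "[0, 1]"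
      and v = "[2, 3, 1, 4, 2, 3, 5, 4, 3, 2, 4, 1, 3, 2]"
      and p = "[1, 1, 0, 0, 0, 0]"
      and q = "[0, 2, 1, 3, 2, 1]"])
    code_simp+

definition F4_star_star_rows :: "int list list" where
  "F4_star_star_rows =
    [[0, 2, -1, 0, -1, 0], [-2, 0, 1, 0, 1, 0], [1, -1, 0, 1, 0, 0], [0, 0, -1, 0, 0, 0],
     [2, -2, 0, 0, 0, 1], [0, 0, 0, 0, -1, 0]]"

lemma F4_star_star_rows_mutates_to_ping_pong: "mutates_to_ping_pong (rows_mat F4_star_star_rows)"
  by (rule mutates_to_ping_pongI[where d = 0 and i = 0 and j = 1 and k = 6 and l = 6
      and ks = "[]"
      and u = "[4, 0, 2, 3, 4, 5, 1, 2, 5, 4, 3, 2, 0, 4]"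
      and v = "[0, 4, 0, 2, 3, 4, 5, 0, 3, 5, 4, 3, 2, 0, 4, 0]"
      and p = "[2, 1, 2, 1, 2, 1]"
      and q = "[3, 0, 2, 1, 2, 1]"])
    code_simp+

definition F4_star_star_rows' :: "int list list" where
  "F4_star_star_rows' =
    [[0, 2, -1, 0, -2, 0], [-2, 0, 1, 0, 2, 0], [1, -1, 0, 1, 0, 0], [0, 0, -1, 0, 0, 0],
     [1, -1, 0, 0, 0, 1], [0, 0, 0, 0, -1, 0]]"

lemma F4_star_star_rows'_mutates_to_ping_pong: "mutates_to_ping_pong (rows_mat F4_star_star_rows')"
  by (rule mutates_to_ping_pongI[where d = 0 and i = 0 and j = 1 and k = 6 and l = 6
      and ks = "[]"
      and u = "[4, 0, 2, 3, 4, 5, 1, 2, 5, 4, 3, 2, 0, 4]"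
      and v = "[0, 4, 0, 2, 3, 4, 5, 0, 3, 5, 4, 3, 2, 0, 4, 0]"
      and p = "[2, 1, 2, 1, 4, 2]"
      and q = "[3, 0, 2, 1, 4, 2]"])
    code_simp+

section \<open>Identifying the matrices with the given diagrams\<close>

lemma X6_eq: "X6 = (6, set [(0, 1, 1), (1, 2, 4), (2, 0, 1), (0, 3, 1), (3, 4, 4), (4, 0, 1), (0, 5, 1)])"
  by (simp add: X6_def)

lemma X7_eq: "X7 = (7, set [(0, 1, 1), (1, 2, 4), (2, 0, 1), (0, 3, 1), (3, 4, 4), (4, 0, 1),
    (0, 5, 1), (5, 6, 4), (6, 0, 1)])"
  by (simp add: X7_def)

lemmas simply_laced_diagram_eqs = X6_eq X7_eq
  E6_11_def[unfolded three_arms_eq] E7_11_def[unfolded three_arms_eq] E8_11_def[unfolded three_arms_eq]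

lemma simply_laced_diagram_mutates_to_ping_pong:
  assumes N: "N \<in> carrier_mat n n" "skew_weights d N" "diagram_of N \<in> {X6, X7, E6_11, E7_11, E8_11}"
  shows "mutates_to_ping_pong N"
proof -
  have *: "mutates_to_ping_pong N"
    if "diagram_of N = (m, set A)" "mutates_to_ping_pong (rows_mat M)"
      "rows_supported M A \<and> simply_laced_rows M A \<and> length M = m" for A M m
  proof -
    have "m = n" using that(1) N(1) by (simp add: diagram_of_def)
    then show ?thesis using eq_simply_laced_rows[OF N(1,2)] that by blast
  qed
  consider "diagram_of N = X6" | "diagram_of N = X7" | "diagram_of N = E6_11"
    | "diagram_of N = E7_11" | "diagram_of N = E8_11"
    using N(3) by blast
  then show ?thesis
  proof cases
    case 1
    show ?thesis
      by (rule *[OF 1[unfolded simply_laced_diagram_eqs] X6_rows_mutates_to_ping_pong]) code_simp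
  next
    case 2
    show ?thesis
      by (rule *[OF 2[unfolded simply_laced_diagram_eqs] X7_rows_mutates_to_ping_pong]) code_simp
  next
    case 3
    show ?thesis
      by (rule *[OF 3[unfolded simply_laced_diagram_eqs] E6_11_rows_mutates_to_ping_pong]) code_simp
  next
    case 4
    show ?thesis
      by (rule *[OF 4[unfolded simply_laced_diagram_eqs] E7_11_rows_mutates_to_ping_pong]) code_simp
  next
    case 5
    show ?thesis
      by (rule *[OF 5[unfolded simply_laced_diagram_eqs] E8_11_rows_mutates_to_ping_pong]) code_simp
  qed
qed

text \<open>Around the triangle 0, 1, 2 the ratios of symmetrizing weights multiply to 1. The
  weight-4 arrow contributes 4, 1 or 1/4, the others 3 or 1/3 each; so the first is 1 and the other
  two are inverse, which leaves two matrices.\<close>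

lemma G2_star_plus_mutates_to_ping_pong:
  assumes N: "N \<in> carrier_mat n n" "skew_weights d N" "diagram_of N = G2_star_plus"
  shows "mutates_to_ping_pong N"
proof -
  define A :: "(nat \<times> nat \<times> int) list" where
    "A = [(0, 1, 4), (1, 2, 3), (2, 0, 3), (2, 3, 1)]"
  have A: "diagram_of N = (4, set A)" using N(3) by (simp add: G2_star_plus_def A_def)
  have "n = 4" using A N(1) by (simp add: diagram_of_def)
  note N' = N(1)[unfolded \<open>n = 4\<close>] N(2) A
  note e = arrow_entries[OF A N(2)] and pos = diagram_arrow_skew_weights(1)[OF A N(2)]
  have "(0, 1, 4) \<in> set A" by (simp add: A_def)
  note a01 = e(4)[OF this] pos[OF this]
  have "(1, 2, 3) \<in> set A" by (simp add: A_def)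
  note a12 = e(3)[OF this] pos[OF this]
  have "(2, 0, 3) \<in> set A" by (simp add: A_def)
  note a20 = e(3)[OF this] pos[OF this]
  have "(2, 3, 1) \<in> set A" by (simp add: A_def)
  note a23 = e(1)[OF this] pos[OF this]
  have "N $$ (0, 1) = 2 \<and> N $$ (1, 0) = -2 \<and> N $$ (1, 2) = 1 \<and> N $$ (2, 1) = -3
      \<and> N $$ (2, 0) = 3 \<and> N $$ (0, 2) = -1 \<and> N $$ (2, 3) = 1 \<and> N $$ (3, 2) =
      -1 \<or>
      N $$ (0, 1) = 2 \<and> N $$ (1, 0) = -2 \<and> N $$ (1, 2) = 3 \<and> N $$ (2, 1) = -1
      \<and> N $$ (2, 0) = 1 \<and> N $$ (0, 2) = -3 \<and> N $$ (2, 3) = 1 \<and> N $$ (3, 2) =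
      -1"
    using a01 a12 a20 a23
    by (elim disjE conjE; (linarith | simp))
  then have "(\<forall>(i, j, w) \<in> set A. N $$ (i, j) = G2_star_plus_rows ! i ! j \<and> N $$ (j, i) = G2_star_plus_rows ! j ! i) \<or>
      (\<forall>(i, j, w) \<in> set A. N $$ (i, j) = G2_star_plus_rows' ! i ! j \<and> N $$ (j, i) = G2_star_plus_rows' ! j ! i)"
    by (elim disjE) (simp_all add: A_def G2_star_plus_rows_def G2_star_plus_rows'_def)
  moreover have "rows_supported G2_star_plus_rows A \<and> length G2_star_plus_rows = 4"
    "rows_supported G2_star_plus_rows' A \<and> length G2_star_plus_rows' = 4"
    unfolding A_def by code_simp+
  ultimately have "N = rows_mat G2_star_plus_rows \<or> N = rows_mat G2_star_plus_rows'"
    using eq_rows_matI[OF N', of G2_star_plus_rows] eq_rows_matI[OF N', of G2_star_plus_rows'] by fast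
  then show ?thesis
    using G2_star_plus_rows_mutates_to_ping_pong G2_star_plus_rows'_mutates_to_ping_pong by metis
qed

lemma G2_star_star_mutates_to_ping_pong:
  assumes N: "N \<in> carrier_mat n n" "skew_weights d N" "diagram_of N = G2_star_star"
  shows "mutates_to_ping_pong N"
proof -
  define A :: "(nat \<times> nat \<times> int) list" where
    "A = [(0, 1, 4), (1, 2, 1), (2, 0, 1), (1, 3, 3), (3, 0, 3)]"
  have A: "diagram_of N = (4, set A)" using N(3) by (simp add: G2_star_star_def A_def)
  have "n = 4" using A N(1) by (simp add: diagram_of_def)
  note N' = N(1)[unfolded \<open>n = 4\<close>] N(2) A
  note e = arrow_entries[OF A N(2)] and pos = diagram_arrow_skew_weights(1)[OF A N(2)]
  have "(0, 1, 4) \<in> set A" by (simp add: A_def)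
  note a01 = e(4)[OF this] pos[OF this]
  have "(1, 2, 1) \<in> set A" by (simp add: A_def)
  note a12 = e(1)[OF this] pos[OF this]
  have "(2, 0, 1) \<in> set A" by (simp add: A_def)
  note a20 = e(1)[OF this] pos[OF this]
  have "(1, 3, 3) \<in> set A" by (simp add: A_def)
  note a13 = e(3)[OF this] pos[OF this]
  have "(3, 0, 3) \<in> set A" by (simp add: A_def)
  note a30 = e(3)[OF this] pos[OF this]
  have "N $$ (0, 1) = 2 \<and> N $$ (1, 0) = -2 \<and> N $$ (1, 2) = 1 \<and> N $$ (2, 1) = -1
      \<and> N $$ (2, 0) = 1 \<and> N $$ (0, 2) = -1 \<and> N $$ (1, 3) = 1 \<and> N $$ (3, 1) =
      -3 \<and> N $$ (3, 0) = 3 \<and> N $$ (0, 3) = -1 \<or>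
      N $$ (0, 1) = 2 \<and> N $$ (1, 0) = -2 \<and> N $$ (1, 2) = 1 \<and> N $$ (2, 1) = -1
      \<and> N $$ (2, 0) = 1 \<and> N $$ (0, 2) = -1 \<and> N $$ (1, 3) = 3 \<and> N $$ (3, 1) =
      -1 \<and> N $$ (3, 0) = 1 \<and> N $$ (0, 3) = -3"
    using a01 a12 a20 a13 a30
    by (elim disjE conjE; (linarith | simp))
  then have "(\<forall>(i, j, w) \<in> set A. N $$ (i, j) = G2_star_star_rows ! i ! j \<and> N $$ (j, i) = G2_star_star_rows ! j ! i) \<or>
      (\<forall>(i, j, w) \<in> set A. N $$ (i, j) = G2_star_star_rows' ! i ! j \<and> N $$ (j, i) = G2_star_star_rows' ! j ! i)"
    by (elim disjE) (simp_all add: A_def G2_star_star_rows_def G2_star_star_rows'_def)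
  moreover have "rows_supported G2_star_star_rows A \<and> length G2_star_star_rows = 4"
    "rows_supported G2_star_star_rows' A \<and> length G2_star_star_rows' = 4"
    unfolding A_def by code_simp+
  ultimately have "N = rows_mat G2_star_star_rows \<or> N = rows_mat G2_star_star_rows'"
    using eq_rows_matI[OF N', of G2_star_star_rows] eq_rows_matI[OF N', of G2_star_star_rows'] by fast
  then show ?thesis
    using G2_star_star_rows_mutates_to_ping_pong G2_star_star_rows'_mutates_to_ping_pong by metis
qed

text \<open>The triangle 0, 1, 3 alone is not decisive, because 2 times 2 could compensate a ratio
  1/4. The weight-1 arrows through vertex 2 give \<open>d 0 = d 1\<close>, and then the two weight-2
  ratios must be inverse. \<open>F4_star_star\<close> is settled likewise, with vertex 4 in place of
  3.\<close>

lemma F4_star_plus_mutates_to_ping_pong: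
  assumes N: "N \<in> carrier_mat n n" "skew_weights d N" "diagram_of N = F4_star_plus"
  shows "mutates_to_ping_pong N"
proof -
  define A :: "(nat \<times> nat \<times> int) list" where
    "A = [(0, 1, 4), (1, 2, 1), (2, 0, 1), (1, 3, 2), (3, 0, 2), (3, 4, 1), (4, 5, 1)]"
  have A: "diagram_of N = (6, set A)" using N(3) by (simp add: F4_star_plus_def A_def)
  have "n = 6" using A N(1) by (simp add: diagram_of_def)
  note N' = N(1)[unfolded \<open>n = 6\<close>] N(2) A
  note e = arrow_entries[OF A N(2)] and pos = diagram_arrow_skew_weights(1)[OF A N(2)]
  have "(0, 1, 4) \<in> set A" by (simp add: A_def)
  note a01 = e(4)[OF this] pos[OF this]
  have "(1, 2, 1) \<in> set A" by (simp add: A_def)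
  note a12 = e(1)[OF this] pos[OF this]
  have "(2, 0, 1) \<in> set A" by (simp add: A_def)
  note a20 = e(1)[OF this] pos[OF this]
  have "(1, 3, 2) \<in> set A" by (simp add: A_def)
  note a13 = e(2)[OF this] pos[OF this]
  have "(3, 0, 2) \<in> set A" by (simp add: A_def)
  note a30 = e(2)[OF this] pos[OF this]
  have "(3, 4, 1) \<in> set A" by (simp add: A_def)
  note a34 = e(1)[OF this] pos[OF this]
  have "(4, 5, 1) \<in> set A" by (simp add: A_def)
  note a45 = e(1)[OF this] pos[OF this]
  have "N $$ (0, 1) = 2 \<and> N $$ (1, 0) = -2 \<and> N $$ (1, 2) = 1 \<and> N $$ (2, 1) = -1
      \<and> N $$ (2, 0) = 1 \<and> N $$ (0, 2) = -1 \<and> N $$ (1, 3) = 1 \<and> N $$ (3, 1) =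
      -2 \<and> N $$ (3, 0) = 2 \<and> N $$ (0, 3) = -1 \<and> N $$ (3, 4) = 1 \<and> N $$ (4, 3)
      = -1 \<and> N $$ (4, 5) = 1 \<and> N $$ (5, 4) = -1 \<or>
      N $$ (0, 1) = 2 \<and> N $$ (1, 0) = -2 \<and> N $$ (1, 2) = 1 \<and> N $$ (2, 1) = -1
      \<and> N $$ (2, 0) = 1 \<and> N $$ (0, 2) = -1 \<and> N $$ (1, 3) = 2 \<and> N $$ (3, 1) =
      -1 \<and> N $$ (3, 0) = 1 \<and> N $$ (0, 3) = -2 \<and> N $$ (3, 4) = 1 \<and> N $$ (4, 3)
      = -1 \<and> N $$ (4, 5) = 1 \<and> N $$ (5, 4) = -1"
    using a01 a12 a20 a13 a30 a34 a45
    by (elim disjE conjE; (linarith | simp))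
  then have "(\<forall>(i, j, w) \<in> set A. N $$ (i, j) = F4_star_plus_rows ! i ! j \<and> N $$ (j, i) = F4_star_plus_rows ! j ! i) \<or>
      (\<forall>(i, j, w) \<in> set A. N $$ (i, j) = F4_star_plus_rows' ! i ! j \<and> N $$ (j, i) = F4_star_plus_rows' ! j ! i)"
    by (elim disjE) (simp_all add: A_def F4_star_plus_rows_def F4_star_plus_rows'_def)
  moreover have "rows_supported F4_star_plus_rows A \<and> length F4_star_plus_rows = 6"
    "rows_supported F4_star_plus_rows' A \<and> length F4_star_plus_rows' = 6"
    unfolding A_def by code_simp+
  ultimately have "N = rows_mat F4_star_plus_rows \<or> N = rows_mat F4_star_plus_rows'"
    using eq_rows_matI[OF N', of F4_star_plus_rows] eq_rows_matI[OF N', of F4_star_plus_rows'] by fast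
  then show ?thesis
    using F4_star_plus_rows_mutates_to_ping_pong F4_star_plus_rows'_mutates_to_ping_pong by metis
qed

lemma F4_star_star_mutates_to_ping_pong:
  assumes N: "N \<in> carrier_mat n n" "skew_weights d N" "diagram_of N = F4_star_star"
  shows "mutates_to_ping_pong N"
proof -
  define A :: "(nat \<times> nat \<times> int) list" where
    "A = [(0, 1, 4), (1, 2, 1), (2, 0, 1), (2, 3, 1), (1, 4, 2), (4, 0, 2), (4, 5, 1)]"
  have A: "diagram_of N = (6, set A)" using N(3) by (simp add: F4_star_star_def A_def)
  have "n = 6" using A N(1) by (simp add: diagram_of_def)
  note N' = N(1)[unfolded \<open>n = 6\<close>] N(2) A
  note e = arrow_entries[OF A N(2)] and pos = diagram_arrow_skew_weights(1)[OF A N(2)]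
  have "(0, 1, 4) \<in> set A" by (simp add: A_def)
  note a01 = e(4)[OF this] pos[OF this]
  have "(1, 2, 1) \<in> set A" by (simp add: A_def)
  note a12 = e(1)[OF this] pos[OF this]
  have "(2, 0, 1) \<in> set A" by (simp add: A_def)
  note a20 = e(1)[OF this] pos[OF this]
  have "(2, 3, 1) \<in> set A" by (simp add: A_def)
  note a23 = e(1)[OF this] pos[OF this]
  have "(1, 4, 2) \<in> set A" by (simp add: A_def)
  note a14 = e(2)[OF this] pos[OF this]
  have "(4, 0, 2) \<in> set A" by (simp add: A_def)
  note a40 = e(2)[OF this] pos[OF this]
  have "(4, 5, 1) \<in> set A" by (simp add: A_def)
  note a45 = e(1)[OF this] pos[OF this]
  have "N $$ (0, 1) = 2 \<and> N $$ (1, 0) = -2 \<and> N $$ (1, 2) = 1 \<and> N $$ (2, 1) = -1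
      \<and> N $$ (2, 0) = 1 \<and> N $$ (0, 2) = -1 \<and> N $$ (2, 3) = 1 \<and> N $$ (3, 2) =
      -1 \<and> N $$ (1, 4) = 1 \<and> N $$ (4, 1) = -2 \<and> N $$ (4, 0) = 2 \<and> N $$ (0, 4)
      = -1 \<and> N $$ (4, 5) = 1 \<and> N $$ (5, 4) = -1 \<or>
      N $$ (0, 1) = 2 \<and> N $$ (1, 0) = -2 \<and> N $$ (1, 2) = 1 \<and> N $$ (2, 1) = -1
      \<and> N $$ (2, 0) = 1 \<and> N $$ (0, 2) = -1 \<and> N $$ (2, 3) = 1 \<and> N $$ (3, 2) =
      -1 \<and> N $$ (1, 4) = 2 \<and> N $$ (4, 1) = -1 \<and> N $$ (4, 0) = 1 \<and> N $$ (0, 4)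
      = -2 \<and> N $$ (4, 5) = 1 \<and> N $$ (5, 4) = -1"
    using a01 a12 a20 a23 a14 a40 a45
    by (elim disjE conjE; (linarith | simp))
  then have "(\<forall>(i, j, w) \<in> set A. N $$ (i, j) = F4_star_star_rows ! i ! j \<and> N $$ (j, i) = F4_star_star_rows ! j ! i) \<or>
      (\<forall>(i, j, w) \<in> set A. N $$ (i, j) = F4_star_star_rows' ! i ! j \<and> N $$ (j, i) = F4_star_star_rows' ! j ! i)"
    by (elim disjE) (simp_all add: A_def F4_star_star_rows_def F4_star_star_rows'_def)
  moreover have "rows_supported F4_star_star_rows A \<and> length F4_star_star_rows = 6"
    "rows_supported F4_star_star_rows' A \<and> length F4_star_star_rows' = 6"
    unfolding A_def by code_simp+
  ultimately have "N = rows_mat F4_star_star_rows \<or> N = rows_mat F4_star_star_rows'"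
    using eq_rows_matI[OF N', of F4_star_star_rows] eq_rows_matI[OF N', of F4_star_star_rows'] by fast
  then show ?thesis
    using F4_star_star_rows_mutates_to_ping_pong F4_star_star_rows'_mutates_to_ping_pong by metis
qed

lemma diagram_mutates_to_ping_pong:
  assumes "N \<in> carrier_mat n n" "skew_weights d N"
    and "diagram_of N \<in> {X6, X7, E6_11, E7_11, E8_11,
               G2_star_plus, G2_star_star, F4_star_plus, F4_star_star}"
  shows "mutates_to_ping_pong N"
  using assms(3) simply_laced_diagram_mutates_to_ping_pong[OF assms(1,2)]
    G2_star_plus_mutates_to_ping_pong[OF assms(1,2)] G2_star_star_mutates_to_ping_pong[OF assms(1,2)]
    F4_star_plus_mutates_to_ping_pong[OF assms(1,2)] F4_star_star_mutates_to_ping_pong[OF assms(1,2)]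
  by blast

theorem theorem5p1:
  fixes B :: "int mat"
  assumes "skew_symmetrizable B"
    and "\<exists>S \<in> {X6, X7, E6_11, E7_11, E8_11,
               G2_star_plus, G2_star_star, F4_star_plus, F4_star_star}. of_diagram_type B S"
  shows "exponential_growth B"
proof -
  define n where "n = dim_row B"
  have Bn: "B \<in> carrier_mat n n" using assms(1) by (auto simp: skew_symmetrizable_def n_def)
  obtain d where d: "skew_weights d B"
    using assms(1) by (rule skew_symmetrizable_imp_skew_weights)
  obtain S ks \<pi> where S: "S \<in> {X6, X7, E6_11, E7_11, E8_11,
               G2_star_plus, G2_star_star, F4_star_plus, F4_star_star}"
    and ks: "set ks \<subseteq> {..<n}" and \<pi>: "\<pi> permutes {..<n}"
    and dia: "diagram_of (permute_mat \<pi> (foldl mutate_mat B ks)) \<in> {S, reverse_diagram S}"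
    using assms(2) unfolding of_diagram_type_def n_def by blast
  define B' where "B' = foldl mutate_mat B ks"
  define N where "N = permute_mat \<pi> B'"
  have B'n: "B' \<in> carrier_mat n n" using Bn by (simp add: B'_def)
  then have Nn: "N \<in> carrier_mat n n" by (simp add: N_def)
  have "skew_weights d B'" unfolding B'_def by (rule foldl_skew_weights[OF d Bn ks])
  then have dN: "skew_weights (d \<circ> \<pi>) N"
    unfolding N_def by (rule skew_weights_permute[OF _ B'n \<pi>])
  have "mutates_to_ping_pong N"
  proof (cases "diagram_of N = S")
    case True
    then show ?thesis using diagram_mutates_to_ping_pong[OF Nn dN] S by simp
  next
    \<comment> \<open>Here \<open>N\<close> shows the reversed diagram, so \<open>- N\<close> shows
      \<open>S\<close> itself, and the property returns to \<open>N\<close> by a second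
      negation.\<close>
    case False
    then have "diagram_of (- N) = S"
      using dia diagram_of_uminus[OF Nn dN] by (simp add: N_def B'_def)
    moreover have Nn': "- N \<in> carrier_mat n n" using Nn by simp
    ultimately have "mutates_to_ping_pong (- N)"
      using diagram_mutates_to_ping_pong[OF _ skew_weights_uminus[OF dN Nn]] S by blast
    moreover have "- (- N) = N" using Nn by (intro eq_matI) auto
    ultimately show ?thesis using mutates_to_ping_pong_uminus[OF _ Nn'] by metis
  qed
  then have "mutates_to_ping_pong B'"
    using mutates_to_ping_pong_permute[OF _ Nn permutes_inv[OF \<pi>]] permute_mat_inv[OF B'n \<pi>]
    by (simp add: N_def)
  then obtain ls where ls: "set ls \<subseteq> {..<n}" "ping_pong (foldl mutate_mat B' ls)"
    using B'n by (auto simp: mutates_to_ping_pong_def)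
  show ?thesis
  proof (rule ping_pong_exponential_growth[OF assms(1)])
    show "set (ks @ ls) \<subseteq> {..<dim_row B}" using ks ls by (simp add: n_def)
    show "ping_pong (foldl mutate_mat B (ks @ ls))" using ls by (simp add: B'_def)
  qed
qed

end
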